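(* Assume that $(z^*,\boldsymbol{A})$ is generated from a stochastic block model with random labels, fully observed, with parameters $(\alpha^*,\boldsymbol{Q}^* )\in\mathcal{Q}$ such that: (A1) $\alpha^*=\alpha^0$ for some fixed $\alpha^0=(\alpha^0_1,\dots,\alpha^0_k)$ with $\alpha^0_a>0$ for all $a\in\{1,\dots,k\}$; (A2) $\boldsymbol{Q}^*=\rho_n\boldsymbol{Q}^0$ for some fixed symmetric $k\times k$ matrix $\boldsymbol{Q}^0$ with positive entries such that $\sum_{a,b=1}^k\alpha^0_a\alpha^0_b\boldsymbol{Q}^0_{ab}=1$. Assume moreover that $\boldsymbol{Q}^0$ has no identical columns and that $\rho_n\gg\log(n)/n$. Then $$\mathbb{P}\left(\widehat z^{VAR}\sim\widehat z\right)\to1\quad\text{when } n\to\infty,$$ where $\widehat z^{VAR}$ is the variational estimator and $\widehat z$ the maximum profile likelihood estimator of the label function.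
   Context: The number of communities $k$ is fixed. $a_n\gg b_n$ means $a_n/b_n\to\infty$. $\mathcal{Z}_{n,k}$ is the set of label functions $z:[n]\to[k]$. Stochastic block model with random labels and parameters $(\alpha,\boldsymbol{Q})$: labels $z^*(1),\dots,z^*(n)$ are i.i.d. with $\mathbb{P}(z^*(i)=a)=\alpha_a$; conditionally on $z^*$, $\boldsymbol{A}$ is symmetric with zero diagonal and independent entries $\boldsymbol{A}_{ij}\sim$ Bernoulli$(\boldsymbol{Q}_{z^*(i)z^*(j)})$, $i<j$. All entries of $\boldsymbol{A}$ are observed. $\mathcal{Q}$ is the set of parameters $(\alpha,\boldsymbol{Q})$ of the form (A1)–(A2): $\alpha$ is a probability vector with positive entries and $\boldsymbol{Q}=\rho\,\boldsymbol{Q}'\in(0,1)^{k\times k}_{\rm sym}$ with $\rho>0$, $\boldsymbol{Q}'$ symmetric with positive entries and $\sum_{a,b}\alpha_a\alpha_b\boldsymbol{Q}'_{ab}=1$. One writes $\boldsymbol{Q}\in\mathcal{Q}$ if there is $\alpha$ with $(\alpha,\boldsymbol{Q})\in\mathcal{Q}$. Likelihoods: $\mathcal{L}(\boldsymbol{A};z,\boldsymbol{Q})=\sum_{i<j}\left(\boldsymbol{A}_{ij}\log\boldsymbol{Q}_{z(i)z(j)}+(1-\boldsymbol{A}_{ij})\log(1-\boldsymbol{Q}_{z(i)z(j)})\right)$ and $\mathfrak{l}(\boldsymbol{A};\alpha,\boldsymbol{Q})=\sum_{z\in\mathcal{Z}_{n,k}}\left(\prod_{i\le n}\alpha_{z(i)}\right)\exp(\mathcal{L}(\boldsymbol{A};z,\boldsymbol{Q}))$.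 The posterior of the labels is $\mathbb{P}(z|\boldsymbol{A},\alpha,\boldsymbol{Q})=\left(\prod_i\alpha_{z(i)}\right)\exp(\mathcal{L}(\boldsymbol{A};z,\boldsymbol{Q}))/\mathfrak{l}(\boldsymbol{A};\alpha,\boldsymbol{Q})$. Variational estimator: $\mathcal{T}$ is the set of $\tau=(\tau^1,\dots,\tau^n)$ with each $\tau^i=(\tau^i_1,\dots,\tau^i_k)$ a probability vector, and $\mathbb{P}_\tau(z)=\prod_{i\le n}\tau^i_{z(i)}$. With $KL(\cdot\Vert\cdot)$ the Kullback-Leibler divergence, $$\mathcal{J}(\boldsymbol{A};\tau,\alpha,\boldsymbol{Q})=\log\mathfrak{l}(\boldsymbol{A};\alpha,\boldsymbol{Q})-KL\left(\mathbb{P}_\tau(\cdot)\,\Vert\,\mathbb{P}(\cdot|\boldsymbol{A},\alpha,\boldsymbol{Q})\right),$$ $(\widehat\alpha^{VAR},\widehat{\boldsymbol{Q}}^{VAR},\widehat\tau^{VAR})\in\arg\max_{(\alpha,\boldsymbol{Q})\in\mathcal{Q},\,\tau\in\mathcal{T}}\mathcal{J}(\boldsymbol{A};\tau,\alpha,\boldsymbol{Q})$, and $\widehat z^{VAR}(i)=\arg\max_{a\le k}(\widehat\tau^{VAR})^i_a$ for $i\le n$. Maximum profile likelihood estimator: $(\widehat{\boldsymbol{Q}},\widehat z)\in\arg\min_{\boldsymbol{Q}\in\mathcal{Q},\,z\in\mathcal{Z}_{n,k}}\sum_{i<j}\mathcal{K}(\boldsymbol{A}_{ij},\boldsymbol{Q}_{z(i)z(j)})$,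 where $\mathcal{K}(q,q')=q\log(q/q')+(1-q)\log\frac{1-q}{1-q'}$ with $0\log0=0$ (equivalently, $(\widehat{\boldsymbol{Q}},\widehat z)$ maximizes $\mathcal{L}(\boldsymbol{A};z,\boldsymbol{Q})$). $z\sim z'$ means that there is a permutation $\sigma$ of $\{1,\dots,k\}$ such that $z'=\sigma\circ z$ (equality of labelings up to relabeling of the communities). *)

theory Defs
  imports "HOL-Probability.Probability"
begin

text \<open>
  The \<open>k\<close> communities are the elements of a finite type \<open>'k\<close>, the nodes are \<open>1, \<dots>, n\<close>,
  and label functions are extensional (\<open>undefined\<close> outside \<open>{1..n}\<close>), so that the set of
  labelings is finite. Adjacency matrices are real-valued functions of two indices.
\<close>

definition labelings :: "nat \<Rightarrow> (nat \<Rightarrow> 'k::finite) set" where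
  "labelings n = {1..n} \<rightarrow>\<^sub>E UNIV"

definition node_pairs :: "nat \<Rightarrow> (nat \<times> nat) set" where
  "node_pairs n = {(i, j). 1 \<le> i \<and> i < j \<and> j \<le> n}"

definition prob_vecs :: "(real ^ 'k::finite) set" where
  "prob_vecs = {p. (\<forall>a. 0 \<le> p $ a) \<and> (\<Sum>a\<in>UNIV. p $ a) = 1}"

definition param_set :: "((real ^ 'k::finite) \<times> (real ^ 'k ^ 'k)) set" where
  "param_set = {(\<alpha>, Q).
     \<alpha> \<in> prob_vecs \<and> (\<forall>a. 0 < \<alpha> $ a) \<and>
     transpose Q = Q \<and> (\<forall>a b. 0 < Q $ a $ b \<and> Q $ a $ b < 1) \<and>
     (\<exists>\<rho> Q'. 0 < \<rho> \<and> transpose Q' = Q' \<and> (\<forall>a b. 0 < Q' $ a $ b) \<and>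
        (\<Sum>a\<in>UNIV. \<Sum>b\<in>UNIV. \<alpha> $ a * \<alpha> $ b * Q' $ a $ b) = 1 \<and>
        Q = \<rho> *\<^sub>R Q')}"

definition conn_matrices :: "(real ^ 'k::finite ^ 'k) set" where
  "conn_matrices = {Q. \<exists>\<alpha>. (\<alpha>, Q) \<in> param_set}"


subsection \<open>The stochastic block model with random labels\<close>

text \<open>For \<open>p \<in> prob_vecs\<close> this is the distribution on \<open>'k\<close> with probabilities \<open>p $ a\<close>;
  see \<open>pmf_vec_pmf\<close>.\<close>

definition vec_pmf :: "real ^ 'k::finite \<Rightarrow> 'k pmf" where
  "vec_pmf p = embed_pmf (\<lambda>a. p $ a)"

definition labels_pmf :: "nat \<Rightarrow> real ^ 'k::finite \<Rightarrow> (nat \<Rightarrow> 'k) pmf" where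
  "labels_pmf n \<alpha> = Pi_pmf {1..n} undefined (\<lambda>_. vec_pmf \<alpha>)"

text \<open>The independent edge indicators \<open>e (i, j)\<close>, \<open>i < j\<close>, are drawn first. The default value
  \<open>False\<close> makes the diagonal, and all entries with an index outside \<open>{1..n}\<close>, equal to zero.\<close>

definition adjacency_pmf ::
    "nat \<Rightarrow> real ^ 'k::finite ^ 'k \<Rightarrow> (nat \<Rightarrow> 'k) \<Rightarrow> (nat \<Rightarrow> nat \<Rightarrow> real) pmf" where
  "adjacency_pmf n Q z =
     map_pmf (\<lambda>e i j. of_bool (e (min i j, max i j)))
       (Pi_pmf (node_pairs n) False (\<lambda>(i, j). bernoulli_pmf (Q $ z i $ z j)))"

definition sbm_pmf ::
    "nat \<Rightarrow> real ^ 'k::finite \<Rightarrow> real ^ 'k ^ 'k \<Rightarrow> ((nat \<Rightarrow> 'k) \<times> (nat \<Rightarrow> nat \<Rightarrow> real)) pmf" where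
  "sbm_pmf n \<alpha> Q =
     bind_pmf (labels_pmf n \<alpha>) (\<lambda>z. map_pmf (\<lambda>A. (z, A)) (adjacency_pmf n Q z))"


subsection \<open>Likelihoods and posterior\<close>

definition label_prior :: "nat \<Rightarrow> real ^ 'k::finite \<Rightarrow> (nat \<Rightarrow> 'k) \<Rightarrow> real" where
  "label_prior n \<alpha> z = (\<Prod>i\<in>{1..n}. \<alpha> $ z i)"

definition cond_loglik ::
    "nat \<Rightarrow> (nat \<Rightarrow> nat \<Rightarrow> real) \<Rightarrow> (nat \<Rightarrow> 'k::finite) \<Rightarrow> real ^ 'k ^ 'k \<Rightarrow> real" where
  "cond_loglik n A z Q =
     (\<Sum>(i, j)\<in>node_pairs n. A i j * ln (Q $ z i $ z j) + (1 - A i j) * ln (1 - Q $ z i $ z j))"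

definition marginal_lik ::
    "nat \<Rightarrow> (nat \<Rightarrow> nat \<Rightarrow> real) \<Rightarrow> real ^ 'k::finite \<Rightarrow> real ^ 'k ^ 'k \<Rightarrow> real" where
  "marginal_lik n A \<alpha> Q = (\<Sum>z\<in>labelings n. label_prior n \<alpha> z * exp (cond_loglik n A z Q))"

definition posterior ::
    "nat \<Rightarrow> (nat \<Rightarrow> nat \<Rightarrow> real) \<Rightarrow> real ^ 'k::finite \<Rightarrow> real ^ 'k ^ 'k \<Rightarrow> (nat \<Rightarrow> 'k) \<Rightarrow> real" where
  "posterior n A \<alpha> Q z = label_prior n \<alpha> z * exp (cond_loglik n A z Q) / marginal_lik n A \<alpha> Q"


subsection \<open>The variational estimator\<close>

definition var_params :: "nat \<Rightarrow> (nat \<Rightarrow> real ^ 'k::finite) set" where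
  "var_params n = {1..n} \<rightarrow>\<^sub>E prob_vecs"

definition var_prob :: "nat \<Rightarrow> (nat \<Rightarrow> real ^ 'k::finite) \<Rightarrow> (nat \<Rightarrow> 'k) \<Rightarrow> real" where
  "var_prob n \<tau> z = (\<Prod>i\<in>{1..n}. \<tau> i $ z i)"

text \<open>\<open>KL_divergence b M N\<close> is the divergence of \<open>N\<close> from the reference measure \<open>M\<close>, with
  logarithms to base \<open>b\<close>: the posterior is the first measure argument. See
  \<open>var_objective_eq\<close> for the resulting finite sum.\<close>

definition var_objective ::
    "nat \<Rightarrow> (nat \<Rightarrow> nat \<Rightarrow> real) \<Rightarrow> (nat \<Rightarrow> real ^ 'k::finite) \<Rightarrow> real ^ 'k \<Rightarrow> real ^ 'k ^ 'k \<Rightarrow> real" where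
  "var_objective n A \<tau> \<alpha> Q =
     ln (marginal_lik n A \<alpha> Q) -
     KL_divergence (exp 1)
       (point_measure (labelings n) (\<lambda>z. ennreal (posterior n A \<alpha> Q z)))
       (point_measure (labelings n) (\<lambda>z. ennreal (var_prob n \<tau> z)))"

text \<open>A labeling is a variational estimate if it arises from some maximizer of the objective
  and some choice of the node-wise maximal weights; neither is unique in general.\<close>

definition is_var_labeling ::
    "nat \<Rightarrow> (nat \<Rightarrow> nat \<Rightarrow> real) \<Rightarrow> (nat \<Rightarrow> 'k::finite) \<Rightarrow> bool" where
  "is_var_labeling n A z \<longleftrightarrow> z \<in> labelings n \<and>
     (\<exists>\<alpha> Q \<tau>.
        is_arg_max (\<lambda>(\<alpha>, Q, \<tau>). var_objective n A \<tau> \<alpha> Q)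
          (\<lambda>(\<alpha>, Q, \<tau>). (\<alpha>, Q) \<in> param_set \<and> \<tau> \<in> var_params n) (\<alpha>, Q, \<tau>) \<and>
        (\<forall>i\<in>{1..n}. is_arg_max (\<lambda>a. \<tau> i $ a) (\<lambda>_. True) (z i)))"


subsection \<open>The maximum profile likelihood estimator\<close>

text \<open>The convention \<open>0 log 0 = 0\<close> holds since \<open>ln 0 = 0\<close>.\<close>

definition bernoulli_kl :: "real \<Rightarrow> real \<Rightarrow> real" where
  "bernoulli_kl q q' = q * ln (q / q') + (1 - q) * ln ((1 - q) / (1 - q'))"

definition is_profile_labeling ::
    "nat \<Rightarrow> (nat \<Rightarrow> nat \<Rightarrow> real) \<Rightarrow> (nat \<Rightarrow> 'k::finite) \<Rightarrow> bool" where
  "is_profile_labeling n A z \<longleftrightarrow>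
     (\<exists>Q. is_arg_min (\<lambda>(Q, z). \<Sum>(i, j)\<in>node_pairs n. bernoulli_kl (A i j) (Q $ z i $ z j))
            (\<lambda>(Q, z). Q \<in> conn_matrices \<and> z \<in> labelings n) (Q, z))"


definition relabel_equiv :: "nat \<Rightarrow> (nat \<Rightarrow> 'k) \<Rightarrow> (nat \<Rightarrow> 'k) \<Rightarrow> bool" where
  "relabel_equiv n z z' \<longleftrightarrow> (\<exists>\<sigma>. bij \<sigma> \<and> (\<forall>i\<in>{1..n}. z' i = \<sigma> (z i)))"


subsection \<open>Consistency of the encodings\<close>

lemma pmf_vec_pmf:
  assumes "p \<in> prob_vecs"
  shows "pmf (vec_pmf p) a = p $ a"
  unfolding vec_pmf_def
proof (rule pmf_embed_pmf)
  show "\<And>a. 0 \<le> p $ a"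
    using assms by (auto simp: prob_vecs_def)
  show "(\<integral>\<^sup>+ a. ennreal (p $ a) \<partial>count_space UNIV) = 1"
    using assms by (simp add: nn_integral_count_space_finite prob_vecs_def)
qed

lemma finite_labelings: "finite (labelings n :: (nat \<Rightarrow> 'k::finite) set)"
  by (simp add: labelings_def finite_PiE)

lemma labelings_nonempty: "labelings n \<noteq> {}"
  by (simp add: labelings_def PiE_eq_empty_iff)

lemma label_prior_pos: "(\<alpha>, Q) \<in> param_set \<Longrightarrow> 0 < label_prior n \<alpha> z"
  by (auto simp: param_set_def label_prior_def intro!: prod_pos)

lemma marginal_lik_pos: "(\<alpha>, Q) \<in> param_set \<Longrightarrow> 0 < marginal_lik n A \<alpha> Q"
  unfolding marginal_lik_def
  by (intro sum_pos finite_labelings labelings_nonempty mult_pos_pos label_prior_pos) auto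

lemma posterior_pos: "(\<alpha>, Q) \<in> param_set \<Longrightarrow> 0 < posterior n A \<alpha> Q z"
  by (simp add: posterior_def label_prior_pos marginal_lik_pos)

lemma var_prob_nonneg: "\<tau> \<in> var_params n \<Longrightarrow> 0 \<le> var_prob n \<tau> z"
  unfolding var_prob_def var_params_def prob_vecs_def by (intro prod_nonneg) (auto dest: PiE_mem)

lemma var_objective_eq:
  assumes Q: "(\<alpha>, Q) \<in> param_set" and \<tau>: "\<tau> \<in> var_params n"
  shows "var_objective n A \<tau> \<alpha> Q =
    ln (marginal_lik n A \<alpha> Q) -
    (\<Sum>z\<in>labelings n. var_prob n \<tau> z * ln (var_prob n \<tau> z / posterior n A \<alpha> Q z))"
proof -
  interpret sigma_finite_measure "count_space (labelings n :: (nat \<Rightarrow> 'a) set)"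
    by (intro sigma_finite_measure_count_space_finite finite_labelings)
  have "1 < exp (1::real)" by simp
  then show ?thesis
    using posterior_pos[OF Q, of n A] var_prob_nonneg[OF \<tau>]
    unfolding var_objective_def point_measure_def
    by (subst KL_density_density)
       (auto simp: AE_count_space less_imp_le log_def less_imp_neq[THEN not_sym]
          lebesgue_integral_count_space_finite finite_labelings)
qed

end

theory Submission
  imports Defs
begin

text \<open>
  Both estimators recover the true labels \<open>u\<close> exactly, up to a permutation of the communities, with
  probability tending to one; hence they agree. Write \<open>L\<close> for the conditional log-likelihood
  \<open>cond_loglik\<close>, \<open>P\<close> for the true connectivity matrix \<open>\<rho> n *\<^sub>R Q0\<close>, and regard a labeling as
  the special case of a soft labeling \<open>\<tau>\<close> whose node-wise distributions are point masses.

  The probabilistic input is a Chernoff bound for the square root of the likelihood ratio. For fixed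
  \<open>z\<close> and \<open>Q\<close> the expectation of \<open>exp ((L z Q - L u P) / 2)\<close> is a product of Bernoulli affinities,
  so that \<open>L z Q\<close> falls below \<open>L u P\<close> by twice the total squared Hellinger distance between the two
  edge distributions, up to an error that can be afforded in a union bound
  (\<open>prob_loglik_ratio_large\<close>). Connection probabilities are rounded to a grid of polynomial size,
  and an error of order \<open>ln n\<close> per node at which \<open>z\<close> differs from a relabeling \<open>s \<circ> u\<close> pays for the
  number of such \<open>z\<close>. The resulting event \<open>typical_adjacency\<close> covers all \<open>z\<close> and \<open>Q\<close>
  simultaneously. Since affinities are bounded, it is insensitive to edge probabilities near zero or
  one, where the log-likelihood itself is unbounded.

  The deterministic input is a separation inequality. The expectation over \<open>z \<sim> \<tau>\<close> of the total
  squared Hellinger distance is a sum over pairs of nodes, linear in the weights of either node. If all communities have linear size and the columns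
  of \<open>Q0\<close> are distinct, it is at least of order \<open>\<rho> n * n\<close> times the misfit of \<open>\<tau>\<close>, the total
  weight off \<open>s \<circ> u\<close> for a suitable permutation \<open>s\<close> (\<open>expected_hellinger2_ge\<close>).

  For the estimators themselves only one inequality is used: the expectation of \<open>L\<close> under the
  estimated soft labeling is at least \<open>L u P\<close> minus order \<open>ln n\<close> times one plus the misfit
  (\<open>nearly_optimal\<close>). For the profile likelihood this is immediate. For the variational estimator the
  objective is this expectation minus the divergence of \<open>\<tau>\<close> from the prior; comparing with the point
  mass at \<open>s \<circ> u\<close>, both the entropy and the prior gain only order \<open>ln n\<close> per unit of misfit.

  Together these give that \<open>\<rho> n * n\<close> times the misfit is at most of order \<open>ln n\<close> times one plus the
  misfit. As \<open>\<rho> n * n\<close> is much larger than \<open>ln n\<close>, the misfit is eventually below one half, and then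
  every node has its largest weight at the true label (\<open>nearly_optimal_recovers\<close>).
\<close>


section \<open>Parameters and product weights\<close>

text \<open>Every symmetric matrix with entries between zero and one is admissible: take as scale \<open>\<rho>\<close>
  the average of its entries under \<open>\<alpha>\<close>.\<close>

lemma param_set_iff:
  "(\<alpha>, Q) \<in> param_set \<longleftrightarrow>
     \<alpha> \<in> prob_vecs \<and> (\<forall>a. 0 < \<alpha> $ a) \<and> transpose Q = Q \<and> (\<forall>a b. 0 < Q $ a $ b \<and> Q $ a $ b < 1)"
  (is "?L \<longleftrightarrow> ?R")
proof
  assume R: ?R
  define r where "r = (\<Sum>a\<in>UNIV. \<Sum>b\<in>UNIV. \<alpha> $ a * \<alpha> $ b * Q $ a $ b)"
  have "0 < r"
    unfolding r_def using R by (intro sum_pos) auto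
  moreover have "(\<Sum>a\<in>UNIV. \<Sum>b\<in>UNIV. \<alpha> $ a * \<alpha> $ b * ((1 / r) *\<^sub>R Q) $ a $ b) = 1"
  proof -
    have "(\<Sum>a\<in>UNIV. \<Sum>b\<in>UNIV. \<alpha> $ a * \<alpha> $ b * ((1 / r) *\<^sub>R Q) $ a $ b) = r / r"
      unfolding r_def sum_divide_distrib by simp
    then show ?thesis using \<open>0 < r\<close> by simp
  qed
  moreover have "transpose ((1 / r) *\<^sub>R Q) = (1 / r) *\<^sub>R Q"
    using R by (simp add: transpose_def vec_eq_iff)
  ultimately show ?L
    unfolding param_set_def using R
    by (auto intro!: exI[of _ r] exI[of _ "(1 / r) *\<^sub>R Q"])
qed (auto simp: param_set_def)

lemma sum_labelings_prod:
  fixes g :: "nat \<Rightarrow> 'k::finite \<Rightarrow> real"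
  shows "(\<Sum>z\<in>labelings n. \<Prod>i\<in>{1..n}. g i (z i)) = (\<Prod>i\<in>{1..n}. \<Sum>a\<in>UNIV. g i a)"
  unfolding labelings_def by (subst prod_sum_PiE) auto

lemma var_params_nth:
  assumes "\<tau> \<in> var_params n" "i \<in> {1..n}"
  shows "0 \<le> \<tau> i $ a" "(\<Sum>a\<in>UNIV. \<tau> i $ a) = 1" "\<tau> i $ a \<le> 1"
proof -
  have "\<tau> i \<in> prob_vecs" using assms by (auto simp: var_params_def dest: PiE_mem)
  then have *: "\<And>a. 0 \<le> \<tau> i $ a" and **: "(\<Sum>a\<in>UNIV. \<tau> i $ a) = 1" by (auto simp: prob_vecs_def)
  show "0 \<le> \<tau> i $ a" "(\<Sum>a\<in>UNIV. \<tau> i $ a) = 1" by (fact * **)+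
  show "\<tau> i $ a \<le> 1"
    using member_le_sum[of a UNIV "\<lambda>a. \<tau> i $ a"] * ** by simp
qed

lemma sum_var_prob:
  assumes "\<tau> \<in> var_params n"
  shows "(\<Sum>z\<in>labelings n. var_prob n \<tau> z) = 1"
  unfolding var_prob_def sum_labelings_prod[of "\<lambda>i a. \<tau> i $ a"]
  by (intro prod.neutral ballI var_params_nth[OF assms])

text \<open>The coordinates are independent under \<open>var_prob n \<tau>\<close>.\<close>

lemma var_prob_marginal:
  fixes f :: "'k::finite \<Rightarrow> real"
  assumes \<tau>: "\<tau> \<in> var_params n" and i: "i \<in> {1..n}"
  shows "(\<Sum>z\<in>labelings n. var_prob n \<tau> z * f (z i)) = (\<Sum>a\<in>UNIV. \<tau> i $ a * f a)"
proof -
  define g where "g l a = \<tau> l $ a * (if l = i then f a else 1)" for l a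
  have "var_prob n \<tau> z * f (z i) = (\<Prod>l\<in>{1..n}. g l (z l))" for z
    using i by (simp add: g_def var_prob_def prod.distrib)
  then have "(\<Sum>z\<in>labelings n. var_prob n \<tau> z * f (z i)) = (\<Prod>l\<in>{1..n}. \<Sum>a\<in>UNIV. g l a)"
    by (simp only: sum_labelings_prod)
  also have "\<dots> = (\<Prod>l\<in>{1..n}. if l = i then \<Sum>a\<in>UNIV. \<tau> i $ a * f a else 1)"
    using var_params_nth[OF \<tau>] by (intro prod.cong) (auto simp: g_def)
  also have "\<dots> = (\<Sum>a\<in>UNIV. \<tau> i $ a * f a)"
    using i by simp
  finally show ?thesis .
qed

lemma var_prob_pair_marginal:
  fixes f :: "'k::finite \<Rightarrow> 'k \<Rightarrow> real"
  assumes \<tau>: "\<tau> \<in> var_params n" and i: "i \<in> {1..n}" and j: "j \<in> {1..n}" and ij: "i \<noteq> j"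
  shows "(\<Sum>z\<in>labelings n. var_prob n \<tau> z * f (z i) (z j)) =
    (\<Sum>a\<in>UNIV. \<Sum>b\<in>UNIV. \<tau> i $ a * \<tau> j $ b * f a b)"
proof -
  have ind: "(\<Sum>z\<in>labelings n. var_prob n \<tau> z * (of_bool (z i = a) * of_bool (z j = b))) =
    \<tau> i $ a * \<tau> j $ b" for a b
  proof -
    define g where "g l c = \<tau> l $ c * (if l = i then of_bool (c = a) else 1) *
      (if l = j then of_bool (c = b) else 1)" for l c
    have "var_prob n \<tau> z * (of_bool (z i = a) * of_bool (z j = b)) = (\<Prod>l\<in>{1..n}. g l (z l))" for z
      using i j by (simp add: g_def var_prob_def prod.distrib)
    then have "(\<Sum>z\<in>labelings n. var_prob n \<tau> z * (of_bool (z i = a) * of_bool (z j = b))) =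
        (\<Prod>l\<in>{1..n}. \<Sum>c\<in>UNIV. g l c)"
      by (simp only: sum_labelings_prod)
    also have "\<dots> = (\<Prod>l\<in>{1..n}. (if l = i then \<tau> i $ a else 1) * (if l = j then \<tau> j $ b else 1))"
      using var_params_nth[OF \<tau>] ij by (intro prod.cong) (auto simp: g_def if_distrib cong: if_cong)
    also have "\<dots> = \<tau> i $ a * \<tau> j $ b"
      using i j by (simp add: prod.distrib)
    finally show ?thesis .
  qed
  have f_eq: "f (z i) (z j) = (\<Sum>a\<in>UNIV. \<Sum>b\<in>UNIV. of_bool (z i = a) * of_bool (z j = b) * f a b)" for z
  proof -
    have "(\<Sum>a\<in>UNIV. \<Sum>b\<in>UNIV. of_bool (z i = a) * of_bool (z j = b) * f a b) =
        (\<Sum>a\<in>UNIV. if a = z i then \<Sum>b\<in>UNIV. if b = z j then f a b else 0 else 0)"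
      by (intro sum.cong) (auto intro!: sum.cong)
    then show ?thesis by simp
  qed
  have "(\<Sum>z\<in>labelings n. var_prob n \<tau> z * f (z i) (z j)) =
      (\<Sum>z\<in>labelings n. \<Sum>a\<in>UNIV. \<Sum>b\<in>UNIV.
        var_prob n \<tau> z * (of_bool (z i = a) * of_bool (z j = b)) * f a b)"
    by (intro sum.cong refl, subst f_eq) (simp only: sum_distrib_left mult.assoc)
  also have "\<dots> = (\<Sum>a\<in>UNIV. \<Sum>b\<in>UNIV. \<Sum>z\<in>labelings n.
        var_prob n \<tau> z * (of_bool (z i = a) * of_bool (z j = b)) * f a b)"
    by (subst sum.swap, intro sum.cong refl, subst sum.swap, rule refl)
  also have "\<dots> = (\<Sum>a\<in>UNIV. \<Sum>b\<in>UNIV. \<tau> i $ a * \<tau> j $ b * f a b)"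
    by (simp add: sum_distrib_right[symmetric] ind)
  finally show ?thesis .
qed

lemma finite_node_pairs: "finite (node_pairs n)"
  by (rule finite_subset[of _ "{1..n} \<times> {1..n}"]) (auto simp: node_pairs_def)

lemma card_node_pairs_le: "card (node_pairs n) \<le> n ^ 2"
proof -
  have "card (node_pairs n) \<le> card ({1..n} \<times> {1..n})"
    by (intro card_mono) (auto simp: node_pairs_def)
  then show ?thesis by (simp add: card_cartesian_product power2_eq_square)
qed

lemma sum_node_pairs_symmetric:
  fixes f :: "nat \<Rightarrow> nat \<Rightarrow> real"
  assumes "\<And>i j. f i j = f j i"
  shows "2 * (\<Sum>(i, j)\<in>node_pairs n. f i j) = (\<Sum>i\<in>{1..n}. \<Sum>j\<in>{1..n} - {i}. f i j)"
proof -
  define N' where "N' = {(i, j). (j, i) \<in> node_pairs n}"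
  have "(\<Sum>(i, j)\<in>N'. f i j) = (\<Sum>(i, j)\<in>node_pairs n. f i j)"
    by (rule sum.reindex_bij_witness[of _ "\<lambda>(i, j). (j, i)" "\<lambda>(i, j). (j, i)"])
       (auto simp: N'_def assms)
  moreover have "(SIGMA i:{1..n}. {1..n} - {i}) = node_pairs n \<union> N'"
    by (auto simp: N'_def node_pairs_def)
  moreover have "node_pairs n \<inter> N' = {}" by (auto simp: N'_def node_pairs_def)
  moreover have "finite N'"
    by (rule finite_subset[of _ "{1..n} \<times> {1..n}"]) (auto simp: N'_def node_pairs_def)
  moreover have "(\<Sum>i\<in>{1..n}. \<Sum>j\<in>{1..n} - {i}. f i j) = (\<Sum>(i, j)\<in>(SIGMA i:{1..n}. {1..n} - {i}). f i j)"
    by (subst sum.Sigma) auto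
  ultimately show ?thesis
    by (simp add: sum.union_disjoint finite_node_pairs)
qed


section \<open>Discretizing the connectivity matrix\<close>

text \<open>The grid is fine enough that rounding costs at most one in the log-likelihood of every
  labeling, and it has only polynomially many points, which keeps the union bound affordable.\<close>

definition grid :: "nat \<Rightarrow> (real ^ 'k::finite ^ 'k) set" where
  "grid n = {Q. \<forall>a b. \<exists>m\<in>{1..<2 * n ^ 2}. Q $ a $ b = real m / real (2 * n ^ 2)}"

lemma grid_bounds:
  assumes "Q \<in> grid n"
  shows "0 < Q $ a $ b" "Q $ a $ b < 1"
proof -
  obtain m where m: "m \<in> {1..<2 * n ^ 2}" "Q $ a $ b = real m / real (2 * n ^ 2)"
    using assms unfolding grid_def by (simp only: mem_Collect_eq) blast
  then have "0 < real m" "real m < real (2 * n ^ 2)"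
    by (simp_all only: of_nat_less_iff of_nat_0_less_iff) auto
  moreover from this have "0 < real (2 * n ^ 2)" by linarith
  ultimately show "0 < Q $ a $ b" "Q $ a $ b < 1"
    unfolding m(2) by (simp_all only: zero_less_divide_iff divide_less_eq_1) auto
qed

lemma card_grid:
  "finite (grid n :: (real ^ 'k::finite ^ 'k) set)"
  "card (grid n :: (real ^ 'k ^ 'k) set) \<le> (2 * n ^ 2) ^ (CARD('k) ^ 2)"
proof -
  define M where "M = (UNIV :: ('k \<times> 'k) set) \<rightarrow>\<^sub>E {1..<2 * n ^ 2}"
  define F :: "('k \<times> 'k \<Rightarrow> nat) \<Rightarrow> real ^ 'k ^ 'k" where
    "F m = (\<chi> a b. real (m (a, b)) / real (2 * n ^ 2))" for m
  have fin: "finite M" by (simp add: M_def finite_PiE)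
  have sub: "grid n \<subseteq> F ` M"
  proof
    fix Q :: "real ^ 'k ^ 'k" assume "Q \<in> grid n"
    then obtain m where m: "m a b \<in> {1..<2 * n ^ 2}" "Q $ a $ b = real (m a b) / real (2 * n ^ 2)" for a b
      unfolding grid_def by (simp only: mem_Collect_eq Bex_def) metis
    then have "Q = F (\<lambda>(a, b). m a b)" "(\<lambda>(a, b). m a b) \<in> M"
      by (auto simp: F_def vec_eq_iff M_def)
    then show "Q \<in> F ` M" by blast
  qed
  then show "finite (grid n :: (real ^ 'k ^ 'k) set)"
    using fin finite_subset by blast
  have "card (grid n :: (real ^ 'k ^ 'k) set) \<le> card M"
    using sub fin by (meson card_image_le card_mono finite_imageI le_trans)
  also have "\<dots> = (2 * n ^ 2 - 1) ^ (CARD('k) ^ 2)"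
    by (simp add: M_def card_PiE power2_eq_square)
  also have "\<dots> \<le> (2 * n ^ 2) ^ (CARD('k) ^ 2)"
    by (intro power_mono) auto
  finally show "card (grid n :: (real ^ 'k ^ 'k) set) \<le> (2 * n ^ 2) ^ (CARD('k) ^ 2)" .
qed

text \<open>Rounding towards one half gives up at most a factor \<open>exp (1 / n ^ 2)\<close> in either of the two
  Bernoulli weights, however close to zero or one the probability is.\<close>

lemma exists_rounding:
  fixes q :: real
  assumes q: "0 < q" "q < 1" and n: "0 < n"
  shows "\<exists>q'. (\<exists>m\<in>{1..<2 * n ^ 2}. q' = real m / real (2 * n ^ 2)) \<and>
    ln q \<le> ln q' + 1 / real n ^ 2 \<and> ln (1 - q) \<le> ln (1 - q') + 1 / real n ^ 2"
proof -
  define N where "N = real (2 * n ^ 2)"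
  have N: "0 < N" "2 / N = 1 / real n ^ 2" "N = 2 * real n ^ 2"
    using n by (simp_all add: N_def)
  have ln_le: "ln x \<le> ln y + 2 / N" if "0 < x" "1 / 2 \<le> y" "x - y \<le> 1 / N" for x y :: real
  proof -
    have "ln x - ln y = ln (x / y)" using that by (simp add: ln_div)
    also have "\<dots> \<le> x / y - 1" using that by (intro ln_le_minus_one) auto
    also have "\<dots> = (x - y) / y" using that by (simp add: field_simps)
    also have "\<dots> \<le> (1 / N) / y" using that by (intro divide_right_mono) auto
    also have "\<dots> \<le> (1 / N) / (1 / 2)" using that N by (intro divide_left_mono) auto
    finally show ?thesis by simp
  qed
  show ?thesis
  proof (cases "q \<le> 1 / 2")
    case True
    define m where "m = nat \<lceil>q * N\<rceil>"
    have qN: "0 < q * N" "q * N \<le> real (n ^ 2)" using q N True by (auto simp: mult_mono)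
    have "real m = of_int \<lceil>q * N\<rceil>" using qN by (simp add: m_def)
    then have m: "q * N \<le> real m" "real m \<le> q * N + 1" by linarith+
    have "\<lceil>q * N\<rceil> \<le> int (n ^ 2)" using qN by (intro ceiling_le) (simp only: of_int_of_nat_eq)
    then have "m \<le> n ^ 2" unfolding m_def by linarith
    moreover have "1 \<le> m" using m qN by linarith
    moreover have "0 < n ^ 2" using n by simp
    ultimately have mr: "m \<in> {1..<2 * n ^ 2}" by simp
    have half: "real m / N \<le> 1 / 2" using \<open>m \<le> n ^ 2\<close> N by (simp add: N(3) divide_simps flip: of_nat_power)
    have "q \<le> real m / N" using m N(1) by (simp add: divide_simps)
    then have 1: "ln q \<le> ln (real m / N)" using q by simp
    have "real m / N \<le> (q * N + 1) / N" using m N(1) by (intro divide_right_mono) auto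
    then have "real m / N \<le> q + 1 / N" using N(1) by (simp add: add_divide_distrib)
    then have 2: "ln (1 - q) \<le> ln (1 - real m / N) + 2 / N" using half q by (intro ln_le) auto
    show ?thesis
      using 1 2 mr N(1) unfolding N(2)[symmetric] N_def[symmetric]
      by (intro exI[of _ "real m / N"]) (auto intro!: bexI[of _ m] add_increasing2)
  next
    case False
    define m where "m = nat \<lfloor>q * N\<rfloor>"
    have qN: "real (n ^ 2) \<le> q * N" "q * N < N" using q N False by (auto simp: mult_mono)
    have "0 \<le> q * N" using q N by simp
    then have "real m = of_int \<lfloor>q * N\<rfloor>" by (simp add: m_def)
    then have m: "real m \<le> q * N" "q * N - 1 \<le> real m" by linarith+
    have "int (n ^ 2) \<le> \<lfloor>q * N\<rfloor>" using qN by (simp add: le_floor_iff)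
    then have ge: "n ^ 2 \<le> m" unfolding m_def by linarith
    moreover have "0 < n ^ 2" using n by simp
    moreover have "m < 2 * n ^ 2" using m qN unfolding N_def by linarith
    ultimately have mr: "m \<in> {1..<2 * n ^ 2}" by simp
    have half: "1 / 2 \<le> real m / N" using ge N by (simp add: N(3) divide_simps flip: of_nat_power)
    have le: "real m / N \<le> q" using m N(1) by (simp add: divide_simps)
    then have 1: "ln (1 - q) \<le> ln (1 - real m / N)" using q by simp
    have "(q * N - 1) / N \<le> real m / N" using m N(1) by (intro divide_right_mono) auto
    then have "q - 1 / N \<le> real m / N" using N(1) by (simp add: diff_divide_distrib)
    then have 2: "ln q \<le> ln (real m / N) + 2 / N" using half q by (intro ln_le) auto
    show ?thesis
      using 1 2 mr N(1) unfolding N(2)[symmetric] N_def[symmetric]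
      by (intro exI[of _ "real m / N"]) (auto intro!: bexI[of _ m] add_increasing2)
  qed
qed

lemma cond_loglik_le_grid:
  fixes Q :: "real ^ 'k::finite ^ 'k"
  assumes Q: "\<And>a b. 0 < Q $ a $ b" "\<And>a b. Q $ a $ b < 1" "transpose Q = Q" and n: "0 < n"
  shows "\<exists>Q'\<in>grid n. transpose Q' = Q' \<and>
    (\<forall>A z. (\<forall>i j. A i j \<in> {0, 1}) \<longrightarrow> cond_loglik n A z Q \<le> cond_loglik n A z Q' + 1)"
proof -
  have "\<forall>q\<in>{0<..<1::real}. \<exists>q'. (\<exists>m\<in>{1..<2 * n ^ 2}. q' = real m / real (2 * n ^ 2)) \<and>
    ln q \<le> ln q' + 1 / real n ^ 2 \<and> ln (1 - q) \<le> ln (1 - q') + 1 / real n ^ 2"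
    using exists_rounding n by simp
  then obtain r where r: "\<forall>q\<in>{0<..<1::real}. (\<exists>m\<in>{1..<2 * n ^ 2}. r q = real m / real (2 * n ^ 2)) \<and>
    ln q \<le> ln (r q) + 1 / real n ^ 2 \<and> ln (1 - q) \<le> ln (1 - r q) + 1 / real n ^ 2"
    by (subst (asm) bchoice_iff) blast
  define Q' :: "real ^ 'k ^ 'k" where "Q' = (\<chi> a b. r (Q $ a $ b))"
  have in01: "Q $ a $ b \<in> {0<..<1}" for a b using Q by simp
  have "Q' \<in> grid n" using r in01 by (simp add: grid_def Q'_def)
  moreover have "Q $ a $ b = Q $ b $ a" for a b using Q(3) by (simp add: transpose_def vec_eq_iff)
  then have "transpose Q' = Q'" by (simp add: Q'_def transpose_def vec_eq_iff)
  moreover have "cond_loglik n A z Q \<le> cond_loglik n A z Q' + 1"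
    if A: "\<And>i j. A i j \<in> {0, 1}" for A and z :: "nat \<Rightarrow> 'k"
  proof -
    have "cond_loglik n A z Q \<le> (\<Sum>(i, j)\<in>node_pairs n.
        (A i j * ln (Q' $ z i $ z j) + (1 - A i j) * ln (1 - Q' $ z i $ z j)) + 1 / real n ^ 2)"
      unfolding cond_loglik_def
    proof (intro sum_mono, clarify)
      fix i j
      have "ln (Q $ z i $ z j) \<le> ln (Q' $ z i $ z j) + 1 / real n ^ 2"
        "ln (1 - Q $ z i $ z j) \<le> ln (1 - Q' $ z i $ z j) + 1 / real n ^ 2"
        using r in01 by (auto simp: Q'_def)
      then show "A i j * ln (Q $ z i $ z j) + (1 - A i j) * ln (1 - Q $ z i $ z j)
        \<le> A i j * ln (Q' $ z i $ z j) + (1 - A i j) * ln (1 - Q' $ z i $ z j) + 1 / real n ^ 2"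
        using A[of i j] by auto
    qed
    also have "\<dots> = cond_loglik n A z Q' + real (card (node_pairs n)) / real n ^ 2"
      by (simp add: cond_loglik_def case_prod_unfold sum.distrib)
    also have "real (card (node_pairs n)) / real n ^ 2 \<le> 1"
      using card_node_pairs_le[of n] n by (simp add: divide_simps flip: of_nat_power)
    finally show ?thesis by simp
  qed
  ultimately show ?thesis by blast
qed


section \<open>Likelihood ratios in the true model\<close>

text \<open>The squared Hellinger distance of two Bernoulli distributions, in the form one minus their
  affinity.\<close>

definition hellinger2 :: "real \<Rightarrow> real \<Rightarrow> real" where
  "hellinger2 p q = 1 - sqrt (p * q) - sqrt ((1 - p) * (1 - q))"

lemma hellinger2_ge:
  assumes "0 \<le> p" "p \<le> 1" "0 \<le> q" "q \<le> 1"
  shows "(sqrt p - sqrt q)\<^sup>2 / 2 \<le> hellinger2 p q"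
proof -
  have "0 \<le> (sqrt (1 - p) - sqrt (1 - q))\<^sup>2" by simp
  then show ?thesis
    using assms by (simp add: hellinger2_def power2_diff real_sqrt_mult)
qed

lemma finite_set_Pi_pmf:
  fixes p :: "'a \<Rightarrow> 'b::finite pmf"
  assumes "finite I"
  shows "finite (set_pmf (Pi_pmf I d p))"
  by (rule finite_subset[OF set_Pi_pmf_subset'[OF assms] finite_PiE_dflt]) (use assms in auto)

lemma exponential_Markov_pmf:
  fixes X :: "'a \<Rightarrow> real"
  assumes fin: "finite (set_pmf M)" and E: "measure_pmf.expectation M (\<lambda>x. exp (X x)) \<le> exp b"
  shows "measure_pmf.prob M {x. t \<le> X x} \<le> exp (b - t)"
proof -
  have "measure_pmf.prob M {x \<in> space (measure_pmf M). exp t \<le> exp (X x)} \<le>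
      measure_pmf.expectation M (\<lambda>x. exp (X x)) / exp t"
    by (rule integral_Markov_inequality_measure[of _ _ UNIV]) (auto intro: integrable_measure_pmf_finite fin)
  also have "\<dots> \<le> exp b / exp t"
    using E by (intro divide_right_mono) auto
  finally show ?thesis by (simp add: exp_diff)
qed

text \<open>The expectation of the square root of the likelihood ratio is a product of affinities, and
  each affinity is at most \<open>exp (- hellinger2 p q)\<close>. The bound is uniform in \<open>Q\<close>,
  also where \<open>ln Q\<close> or \<open>ln (1 - Q)\<close> is large.\<close>

lemma prob_loglik_ratio_large:
  fixes P Q :: "real ^ 'k::finite ^ 'k"
  assumes P: "\<And>a b. 0 < P $ a $ b" "\<And>a b. P $ a $ b < 1"
    and Q: "\<And>a b. 0 < Q $ a $ b" "\<And>a b. Q $ a $ b < 1"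
  shows "measure_pmf.prob (adjacency_pmf n P u)
    {A. cond_loglik n A u P + 2 * t \<le> cond_loglik n A z Q +
       2 * (\<Sum>(i, j)\<in>node_pairs n. hellinger2 (P $ u i $ u j) (Q $ z i $ z j))} \<le> exp (- t)"
    (is "measure_pmf.prob _ ?B \<le> _")
proof -
  define p q where "p x = P $ u (fst x) $ u (snd x)" and "q x = Q $ z (fst x) $ z (snd x)" for x
  define H where "H = (\<Sum>x\<in>node_pairs n. hellinger2 (p x) (q x))"
  define M where "M = Pi_pmf (node_pairs n) False (\<lambda>x. bernoulli_pmf (p x))"
  define f where "f x e = (if e then sqrt (q x / p x) else sqrt ((1 - q x) / (1 - p x)))" for x e
  define X where "X e = (\<Sum>x\<in>node_pairs n. ln (f x (e x)))" for e
  have p: "0 < p x" "p x < 1" and q: "0 < q x" "q x < 1" for x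
    using P Q by (auto simp: p_def q_def)
  have f: "0 < f x e" for x e using p q by (auto simp: f_def)
  have fin: "finite (set_pmf M)"
    unfolding M_def by (intro finite_set_Pi_pmf finite_node_pairs)
  have "measure_pmf.expectation M (\<lambda>e. exp (X e)) =
      measure_pmf.expectation M (\<lambda>e. \<Prod>x\<in>node_pairs n. f x (e x))"
    using f by (simp add: X_def exp_sum finite_node_pairs)
  also have "\<dots> = (\<Prod>x\<in>node_pairs n. measure_pmf.expectation (bernoulli_pmf (p x)) (f x))"
    unfolding M_def
    by (rule expectation_prod_Pi_pmf) (auto simp: finite_node_pairs less_imp_le[OF f] intro: integrable_measure_pmf_finite)
  also have "\<dots> \<le> (\<Prod>x\<in>node_pairs n. exp (- hellinger2 (p x) (q x)))"
  proof (intro prod_mono conjI)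
    fix x
    have *: "v * sqrt (w / v) = sqrt (v * w)" if "0 < v" for v w :: real
    proof -
      have "v * sqrt (w / v) = (v / sqrt v) * sqrt w" by (simp add: real_sqrt_divide)
      then show ?thesis using that by (simp add: real_div_sqrt real_sqrt_mult)
    qed
    have pq: "p x * sqrt (q x / p x) = sqrt (p x * q x)"
      "(1 - p x) * sqrt ((1 - q x) / (1 - p x)) = sqrt ((1 - p x) * (1 - q x))"
      using p[of x] by (intro * ; simp)+
    have "measure_pmf.expectation (bernoulli_pmf (p x)) (f x) = 1 + - hellinger2 (p x) (q x)"
      using p[of x] pq by (simp add: f_def hellinger2_def mult.commute)
    also have "\<dots> \<le> exp (- hellinger2 (p x) (q x))" by (rule exp_ge_add_one_self)
    finally show "measure_pmf.expectation (bernoulli_pmf (p x)) (f x) \<le> exp (- hellinger2 (p x) (q x))" .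
    show "0 \<le> measure_pmf.expectation (bernoulli_pmf (p x)) (f x)"
      using f by (intro Bochner_Integration.integral_nonneg less_imp_le)
  qed
  also have "\<dots> = exp (- H)" unfolding H_def sum_negf[symmetric] by (simp only: exp_sum[OF finite_node_pairs])
  finally have E: "measure_pmf.expectation M (\<lambda>e. exp (X e)) \<le> exp (- H)" .

  define Adj where "Adj = (\<lambda>(e :: nat \<times> nat \<Rightarrow> bool) i j. of_bool (e (min i j, max i j)) :: real)"
  have ll: "cond_loglik n (Adj e) z Q = cond_loglik n (Adj e) u P + 2 * X e" for e
  proof -
    have "cond_loglik n (Adj e) z Q - cond_loglik n (Adj e) u P = (\<Sum>x\<in>node_pairs n. 2 * ln (f x (e x)))"
      unfolding cond_loglik_def sum_subtractf[symmetric]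
    proof (intro sum.cong refl, clarify)
      fix i j assume "(i, j) \<in> node_pairs n"
      then have ij: "Adj e i j = of_bool (e (i, j))" by (auto simp: Adj_def node_pairs_def)
      have "2 * ln (f (i, j) (e (i, j))) = (if e (i, j) then ln (q (i, j)) - ln (p (i, j))
          else ln (1 - q (i, j)) - ln (1 - p (i, j)))"
        using p[of "(i, j)"] q[of "(i, j)"] by (simp add: f_def ln_sqrt ln_div)
      then show "Adj e i j * ln (Q $ z i $ z j) + (1 - Adj e i j) * ln (1 - Q $ z i $ z j) -
          (Adj e i j * ln (P $ u i $ u j) + (1 - Adj e i j) * ln (1 - P $ u i $ u j)) =
          2 * ln (f (i, j) (e (i, j)))"
        unfolding ij by (simp add: p_def q_def)
    qed
    then show ?thesis by (simp add: X_def sum_distrib_left)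
  qed
  have "adjacency_pmf n P u = map_pmf Adj M"
    by (simp add: adjacency_pmf_def Adj_def M_def p_def case_prod_unfold)
  then have "measure_pmf.prob (adjacency_pmf n P u) ?B = measure_pmf.prob M (Adj -` ?B)"
    by simp
  also have "Adj -` ?B = {e. t - H \<le> X e}"
    by (auto simp: ll H_def p_def q_def case_prod_unfold)
  also have "measure_pmf.prob M \<dots> \<le> exp (- H - (t - H))"
    by (rule exponential_Markov_pmf[OF fin E])
  finally show ?thesis by simp
qed

definition disagreements :: "nat \<Rightarrow> (nat \<Rightarrow> 'k) \<Rightarrow> (nat \<Rightarrow> 'k) \<Rightarrow> real" where
  "disagreements n z u = (\<Sum>i\<in>{1..n}. of_bool (z i \<noteq> u i))"

text \<open>The allowance \<open>ln n\<close> per disagreement pays for the number of labelings at that distance.\<close>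

lemma sum_exp_disagreements:
  fixes u :: "nat \<Rightarrow> 'k::finite"
  assumes n: "1 \<le> n" and K: "1 \<le> K"
  shows "(\<Sum>z\<in>labelings n. exp (- (K * ((disagreements n z u + 1) * ln (real n))))) \<le>
    exp (real CARD('k)) * real n powr - K"
proof -
  define x where "x = real n powr - K"
  have x: "0 \<le> x" "x = exp (- K * ln (real n))" using n by (auto simp: x_def powr_def)
  have "exp (- (K * ((disagreements n z u + 1) * ln (real n)))) =
      x * (\<Prod>i\<in>{1..n}. if z i = u i then 1 else x)" for z
  proof -
    have "(\<Prod>i\<in>{1..n}. if z i = u i then 1 else x) =
        (\<Prod>i\<in>{1..n}. exp (- K * ln (real n) * of_bool (z i \<noteq> u i)))"
      by (intro prod.cong) (auto simp: x(2))
    also have "\<dots> = exp (- K * ln (real n) * disagreements n z u)"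
      by (simp only: exp_sum[symmetric] disagreements_def sum_distrib_left finite_atLeastAtMost)
    finally show ?thesis by (simp add: x(2) exp_add[symmetric] algebra_simps)
  qed
  then have eq: "(\<Sum>z\<in>labelings n. exp (- (K * ((disagreements n z u + 1) * ln (real n))))) =
      x * (\<Prod>i\<in>{1..n}. \<Sum>a\<in>UNIV. if a = u i then 1 else x)"
    by (simp only: sum_distrib_left[symmetric] sum_labelings_prod[of "\<lambda>i a. if a = u i then 1 else x"])
  have "(\<Prod>i\<in>{1..n}. \<Sum>a\<in>UNIV. if a = u i then 1 else x) \<le> (\<Prod>i\<in>{1..n}. exp (real CARD('k) * x))"
  proof (intro prod_mono conjI)
    fix i
    have "(\<Sum>a\<in>UNIV. if a = u i then 1 else x) \<le> (\<Sum>a\<in>UNIV. (if a = u i then 1 else 0) + x)"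
      using x by (intro sum_mono) auto
    also have "\<dots> = 1 + real CARD('k) * x" by (simp add: sum.distrib)
    also have "\<dots> \<le> exp (real CARD('k) * x)" by (rule exp_ge_add_one_self)
    finally show "(\<Sum>a\<in>UNIV. if a = u i then 1 else x) \<le> exp (real CARD('k) * x)" .
    show "0 \<le> (\<Sum>a\<in>UNIV. if a = u i then 1 else x)" using x by (intro sum_nonneg) auto
  qed
  also have "\<dots> = exp (real CARD('k) * (real n * x))"
    by (simp add: exp_of_nat_mult[symmetric] algebra_simps)
  also have "\<dots> \<le> exp (real CARD('k))"
  proof -
    have "x \<le> real n powr - 1" unfolding x_def using n K by (intro powr_mono) auto
    then have "real n * x \<le> 1" using n by (simp add: powr_minus field_simps)
    then have "real CARD('k) * (real n * x) \<le> real CARD('k) * 1" by (intro mult_left_mono) auto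
    then show ?thesis by simp
  qed
  finally have "(\<Prod>i\<in>{1..n}. \<Sum>a\<in>UNIV. if a = u i then 1 else x) \<le> exp (real CARD('k))" .
  from mult_left_mono[OF this x(1)] show ?thesis
    unfolding eq by (simp add: x_def mult.commute)
qed

text \<open>Under a typical adjacency matrix no pair of a grid matrix and a labeling beats the truth,
  up to the logarithmic allowance. Comparing \<open>z\<close> with every relabeling \<open>s \<circ> u\<close> of the truth
  makes the later choice of the best relabeling free.\<close>

definition typical_adjacency ::
    "nat \<Rightarrow> real ^ 'k::finite ^ 'k \<Rightarrow> (nat \<Rightarrow> 'k) \<Rightarrow> real \<Rightarrow> (nat \<Rightarrow> nat \<Rightarrow> real) \<Rightarrow> bool" where
  "typical_adjacency n P u K A \<longleftrightarrow>
     (\<forall>s :: 'k \<Rightarrow> 'k. \<forall>Q\<in>grid n :: (real ^ 'k ^ 'k) set. \<forall>z\<in>labelings n.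
     cond_loglik n A z Q + 2 * (\<Sum>(i, j)\<in>node_pairs n. hellinger2 (P $ u i $ u j) (Q $ z i $ z j))
     \<le> cond_loglik n A u P + 2 * (K * ((disagreements n z (s \<circ> u) + 1) * ln (real n))))"

text \<open>The value of \<open>K\<close> makes \<open>n powr - K\<close> beat the number of grid matrices, of order
  \<open>n ^ (2 * CARD('k) ^ 2)\<close>, by one power of \<open>n\<close>.\<close>

lemma prob_not_typical_adjacency:
  fixes P :: "real ^ 'k::finite ^ 'k"
  assumes P: "\<And>a b. 0 < P $ a $ b" "\<And>a b. P $ a $ b < 1" and n: "1 \<le> n"
    and K: "K = 2 * real CARD('k) ^ 2 + 1"
  shows "measure_pmf.prob (adjacency_pmf n P u) {A. \<not> typical_adjacency n P u K A} \<le>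
    real CARD('k \<Rightarrow> 'k) * 2 ^ (CARD('k) ^ 2) * exp (real CARD('k)) / real n"
proof -
  let ?M = "adjacency_pmf n P u"
  let ?S = "UNIV :: ('k \<Rightarrow> 'k) set" and ?G = "grid n :: (real ^ 'k ^ 'k) set"
  define t where "t s z = K * ((disagreements n z (s \<circ> u) + 1) * ln (real n))" for s :: "'k \<Rightarrow> 'k" and z
  define B where "B s Q z = {A. cond_loglik n A u P + 2 * t s z \<le> cond_loglik n A z Q +
       2 * (\<Sum>(i, j)\<in>node_pairs n. hellinger2 (P $ u i $ u j) (Q $ z i $ z j))}" for s Q z
  have fin: "finite (?S \<times> ?G \<times> labelings n)"
    by (intro finite_cartesian_product card_grid finite_labelings) simp
  have "{A. \<not> typical_adjacency n P u K A} \<subseteq> (\<Union>(s, Q, z)\<in>?S \<times> ?G \<times> labelings n. B s Q z)"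
  proof
    fix A assume "A \<in> {A. \<not> typical_adjacency n P u K A}"
    then obtain s and Q :: "real ^ 'k ^ 'k" and z where "Q \<in> ?G" "z \<in> labelings n"
      "\<not> cond_loglik n A z Q + 2 * (\<Sum>(i, j)\<in>node_pairs n. hellinger2 (P $ u i $ u j) (Q $ z i $ z j))
        \<le> cond_loglik n A u P + 2 * t s z"
      unfolding typical_adjacency_def t_def by blast
    then have "(s, Q, z) \<in> ?S \<times> ?G \<times> labelings n" "A \<in> B s Q z" by (auto simp: B_def)
    then show "A \<in> (\<Union>(s, Q, z)\<in>?S \<times> ?G \<times> labelings n. B s Q z)" by blast
  qed
  then have "measure_pmf.prob ?M {A. \<not> typical_adjacency n P u K A} \<le>
      measure_pmf.prob ?M (\<Union>(s, Q, z)\<in>?S \<times> ?G \<times> labelings n. B s Q z)"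
    by (intro measure_pmf.finite_measure_mono) auto
  also have "\<dots> \<le> (\<Sum>(s, Q, z)\<in>?S \<times> ?G \<times> labelings n. measure_pmf.prob ?M (B s Q z))"
    unfolding case_prod_unfold by (intro measure_pmf.finite_measure_subadditive_finite fin) auto
  also have "\<dots> \<le> (\<Sum>(s, Q, z)\<in>?S \<times> ?G \<times> labelings n. exp (- t s z))"
  proof (intro sum_mono, clarify)
    fix s :: "'k \<Rightarrow> 'k" and Q :: "real ^ 'k ^ 'k" and z :: "nat \<Rightarrow> 'k" assume "Q \<in> grid n"
    then show "measure_pmf.prob ?M (B s Q z) \<le> exp (- t s z)"
      unfolding B_def using P grid_bounds by (intro prob_loglik_ratio_large) auto
  qed
  also have "\<dots> = (\<Sum>s\<in>?S. \<Sum>Q\<in>?G. \<Sum>z\<in>labelings n. exp (- t s z))"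
    by (simp only: sum.cartesian_product)
  also have "\<dots> \<le> (\<Sum>s\<in>?S. \<Sum>Q\<in>?G. exp (real CARD('k)) * real n powr - K)"
    unfolding t_def using n K by (intro sum_mono sum_exp_disagreements) auto
  also have "\<dots> = real CARD('k \<Rightarrow> 'k) * (real (card ?G) * (exp (real CARD('k)) * real n powr - K))"
    by simp
  also have "\<dots> \<le> real CARD('k \<Rightarrow> 'k) *
      (real ((2 * n ^ 2) ^ (CARD('k) ^ 2)) * (exp (real CARD('k)) * real n powr - K))"
    by (intro mult_left_mono mult_right_mono mult_nonneg_nonneg of_nat_mono card_grid) simp_all
  also have "\<dots> = real CARD('k \<Rightarrow> 'k) * 2 ^ (CARD('k) ^ 2) * exp (real CARD('k)) *
      (real n ^ (2 * CARD('k) ^ 2) * real n powr - K)"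
    by (simp add: power_mult_distrib power_mult)
  also have "real n ^ (2 * CARD('k) ^ 2) * real n powr - K = 1 / real n"
  proof -
    have "real n ^ (2 * CARD('k) ^ 2) = real n powr (2 * real CARD('k) ^ 2)"
      using powr_realpow[of "real n" "2 * CARD('k) ^ 2"] n by simp
    then have "real n ^ (2 * CARD('k) ^ 2) * real n powr - K = real n powr (- 1)"
      by (simp add: K powr_add[symmetric])
    then show ?thesis using n by (simp add: powr_minus inverse_eq_divide)
  qed
  finally show ?thesis by simp
qed


section \<open>Separation of soft labelings from the truth\<close>

text \<open>The expected number of disagreements with \<open>v\<close> when the labels are drawn from \<open>\<tau>\<close>, see
  \<open>expected_disagreements\<close>.\<close>

definition misfit :: "nat \<Rightarrow> (nat \<Rightarrow> real ^ 'k::finite) \<Rightarrow> (nat \<Rightarrow> 'k) \<Rightarrow> real" where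
  "misfit n \<tau> v = (\<Sum>i\<in>{1..n}. 1 - \<tau> i $ v i)"

lemma misfit_bounds:
  assumes \<tau>: "\<tau> \<in> var_params n"
  shows "0 \<le> misfit n \<tau> v" "misfit n \<tau> v \<le> real n"
proof -
  show "0 \<le> misfit n \<tau> v"
    unfolding misfit_def using var_params_nth[OF \<tau>] by (intro sum_nonneg) simp
  have "misfit n \<tau> v \<le> (\<Sum>i\<in>{1..n}. 1)"
    unfolding misfit_def using var_params_nth[OF \<tau>] by (intro sum_mono) simp
  then show "misfit n \<tau> v \<le> real n" by simp
qed

lemma node_weight_le_misfit:
  assumes \<tau>: "\<tau> \<in> var_params n" and i: "i \<in> {1..n}"
  shows "1 - \<tau> i $ v i \<le> misfit n \<tau> v"
  unfolding misfit_def using var_params_nth[OF \<tau>] i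
  by (intro member_le_sum[where f = "\<lambda>i. 1 - \<tau> i $ v i"]) auto

lemma misfit_eq_off_weight:
  assumes \<tau>: "\<tau> \<in> var_params n"
  shows "misfit n \<tau> v = (\<Sum>i\<in>{1..n}. \<Sum>a\<in>UNIV - {v i}. \<tau> i $ a)"
proof -
  have "(\<Sum>a\<in>UNIV. \<tau> i $ a) = \<tau> i $ v i + (\<Sum>a\<in>UNIV - {v i}. \<tau> i $ a)" for i
    by (rule sum.remove) auto
  then show ?thesis
    unfolding misfit_def using var_params_nth(2)[OF \<tau>] by (intro sum.cong refl) (metis add_diff_cancel_left')
qed

lemma expected_disagreements:
  assumes \<tau>: "\<tau> \<in> var_params n"
  shows "(\<Sum>z\<in>labelings n. var_prob n \<tau> z * disagreements n z v) = misfit n \<tau> v"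
proof -
  have "(\<Sum>z\<in>labelings n. var_prob n \<tau> z * disagreements n z v) =
      (\<Sum>i\<in>{1..n}. \<Sum>z\<in>labelings n. var_prob n \<tau> z * of_bool (z i \<noteq> v i))"
    unfolding disagreements_def sum_distrib_left by (rule sum.swap)
  also have "\<dots> = (\<Sum>i\<in>{1..n}. \<Sum>a\<in>UNIV. \<tau> i $ a * of_bool (a \<noteq> v i))"
    by (intro sum.cong refl var_prob_marginal[OF \<tau>, where f = "\<lambda>a. of_bool (a \<noteq> v _)"])
  also have "\<dots> = (\<Sum>i\<in>{1..n}. \<Sum>a\<in>UNIV - {v i}. \<tau> i $ a)"
    by (intro sum.cong refl sum.mono_neutral_cong_right) auto
  finally show ?thesis by (simp only: misfit_eq_off_weight[OF \<tau>])
qed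

text \<open>A fixed share of each true community \<open>d\<close> is carried by some label \<open>s d\<close>. Either \<open>x\<close> does not fit
  \<open>y\<close> on these labels, and then the cost is quadratic in \<open>n\<close> whatever the misfit, or it
  fits, and then the gap between the rows of \<open>y\<close> makes \<open>s\<close> injective and every unit of weight on
  a wrong label costs a multiple of \<open>n\<close>. Pairs \<open>i = j\<close> carry no edge; their
  contribution could be large as \<open>x\<close> is arbitrary, and so they are avoided throughout instead of
  being subtracted at the end.\<close>

lemma soft_labeling_separation:
  fixes u :: "nat \<Rightarrow> 'k::finite" and y x :: "'k \<Rightarrow> 'k \<Rightarrow> real"
  assumes \<tau>: "\<tau> \<in> var_params n"
    and balanced: "\<And>c. \<gamma> * real n \<le> real (card {i\<in>{1..n}. u i = c})"
    and gap: "\<And>c e. c \<noteq> e \<Longrightarrow> \<exists>d. 2 * \<eta> \<le> \<bar>y c d - y e d\<bar>"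
    and \<eta>: "0 < \<eta>" and \<beta>: "\<beta> = \<gamma> / real CARD('k)" and large: "2 \<le> \<beta> * real n"
  shows "\<exists>s. bij s \<and> \<beta>\<^sup>2 * \<eta>\<^sup>2 / 2 * real n * misfit n \<tau> (s \<circ> u) \<le>
    (\<Sum>i\<in>{1..n}. \<Sum>j\<in>{1..n} - {i}. \<Sum>a\<in>UNIV. \<Sum>b\<in>UNIV.
       \<tau> i $ a * \<tau> j $ b * (y (u i) (u j) - x a b)\<^sup>2)" (is "\<exists>s. _ \<and> _ \<le> ?E")
proof -
  note t = var_params_nth[OF \<tau>]
  define m where "m = \<beta> * real n / 2"
  have n0: "0 < real n" using large by (cases "n = 0") auto
  have m0: "0 < m" using large by (simp add: m_def)
  have k0: "0 < real CARD('k)" by simp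
  have \<beta>0: "0 < \<beta>" using large n0 by (simp add: zero_less_mult_pos2[of \<beta> "real n"])
  have \<beta>1: "\<beta> \<le> 1"
  proof -
    have "card {i\<in>{1..n}. u i = c} \<le> card {1..n}" for c by (intro card_mono) auto
    then have "real (card {i\<in>{1..n}. u i = c}) \<le> 1 * real n" for c by simp
    from order_trans[OF balanced this] have "\<gamma> * real n \<le> 1 * real n" .
    then have "\<gamma> \<le> 1" using n0 by simp
    moreover have "1 \<le> CARD('k)" by (simp add: Suc_le_eq)
    then have "1 \<le> real CARD('k)" by linarith
    ultimately have "\<gamma> \<le> real CARD('k)" by (rule order_trans)
    then show ?thesis unfolding \<beta> by (simp add: divide_le_eq)
  qed
  \<comment> \<open>By pigeonhole over the labels, one label carries a share \<open>1 / CARD('k)\<close> of community \<open>d\<close>.\<close>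
  have "\<exists>b. \<beta> * real n \<le> (\<Sum>j\<in>{j\<in>{1..n}. u j = d}. \<tau> j $ b)" for d
  proof (rule ccontr)
    assume "\<nexists>b. \<beta> * real n \<le> (\<Sum>j\<in>{j\<in>{1..n}. u j = d}. \<tau> j $ b)"
    then have "(\<Sum>b\<in>UNIV. \<Sum>j\<in>{j\<in>{1..n}. u j = d}. \<tau> j $ b) < (\<Sum>b\<in>(UNIV :: 'k set). \<beta> * real n)"
      by (intro sum_strict_mono) (auto simp: not_le)
    also have "\<dots> = \<gamma> * real n" using k0 by (simp add: \<beta>)
    also have "(\<Sum>b\<in>UNIV. \<Sum>j\<in>{j\<in>{1..n}. u j = d}. \<tau> j $ b) = (\<Sum>j\<in>{j\<in>{1..n}. u j = d}. 1)"
      by (subst sum.swap, intro sum.cong refl t(2)) auto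
    finally show False using balanced[of d] by simp
  qed
  then obtain s where s: "\<beta> * real n \<le> (\<Sum>j\<in>{j\<in>{1..n}. u j = d}. \<tau> j $ s d)" for d
    by metis
  \<comment> \<open>Leaving out one node costs weight at most one, hence at most half of \<open>\<beta> * n \<ge> 2\<close>.\<close>
  have heavy: "m \<le> (\<Sum>j\<in>{j\<in>{1..n} - {i}. u j = d}. \<tau> j $ s d)" if i: "i \<in> {1..n}" for i d
  proof -
    have "(\<Sum>j\<in>{j\<in>{1..n}. u j = d}. \<tau> j $ s d) \<le> (\<Sum>j\<in>insert i {j\<in>{1..n} - {i}. u j = d}. \<tau> j $ s d)"
      using t(1) i by (intro sum_mono2) auto
    also have "\<dots> = \<tau> i $ s d + (\<Sum>j\<in>{j\<in>{1..n} - {i}. u j = d}. \<tau> j $ s d)"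
      by (subst sum.insert) auto
    finally have "\<beta> * real n - 1 \<le> (\<Sum>j\<in>{j\<in>{1..n} - {i}. u j = d}. \<tau> j $ s d)"
      using s[of d] t(3)[OF i, of "s d"] by linarith
    then show ?thesis using large by (simp add: m_def)
  qed
  define C where "C i a = (\<Sum>j\<in>{1..n} - {i}. \<Sum>b\<in>UNIV. \<tau> j $ b * (y (u i) (u j) - x a b)\<^sup>2)" for i a
  have E: "?E = (\<Sum>i\<in>{1..n}. \<Sum>a\<in>UNIV. \<tau> i $ a * C i a)"
    unfolding C_def sum_distrib_left mult.assoc by (intro sum.cong refl sum.swap)
  have C0: "0 \<le> C i a" for i a
    unfolding C_def using t(1) by (intro sum_nonneg mult_nonneg_nonneg) auto
  have C: "m * \<eta>\<^sup>2 \<le> C i a" if i: "i \<in> {1..n}" and far: "\<eta> \<le> \<bar>y (u i) d - x a (s d)\<bar>" for i a d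
  proof -
    have "m * \<eta>\<^sup>2 \<le> m * (y (u i) d - x a (s d))\<^sup>2"
      using far \<eta> m0 by (intro mult_left_mono) (auto simp: abs_le_square_iff[symmetric])
    also have "\<dots> \<le> (\<Sum>j\<in>{j\<in>{1..n} - {i}. u j = d}. \<tau> j $ s d) * (y (u i) d - x a (s d))\<^sup>2"
      by (intro mult_right_mono heavy i) auto
    also have "\<dots> = (\<Sum>j\<in>{j\<in>{1..n} - {i}. u j = d}. \<tau> j $ s d * (y (u i) (u j) - x a (s d))\<^sup>2)"
      unfolding sum_distrib_right by (intro sum.cong) auto
    also have "\<dots> \<le> (\<Sum>j\<in>{j\<in>{1..n} - {i}. u j = d}. \<Sum>b\<in>UNIV. \<tau> j $ b * (y (u i) (u j) - x a b)\<^sup>2)"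
    proof (intro sum_mono)
      fix j assume "j \<in> {j\<in>{1..n} - {i}. u j = d}"
      then have "\<And>b. 0 \<le> \<tau> j $ b * (y (u i) (u j) - x a b)\<^sup>2" using t(1) by auto
      then show "\<tau> j $ s d * (y (u i) (u j) - x a (s d))\<^sup>2 \<le>
          (\<Sum>b\<in>UNIV. \<tau> j $ b * (y (u i) (u j) - x a b)\<^sup>2)"
        by (intro member_le_sum[where f = "\<lambda>b. \<tau> j $ b * (y (u i) (u j) - x a b)\<^sup>2"]) auto
    qed
    also have "\<dots> \<le> C i a"
      unfolding C_def using t(1) by (intro sum_mono2 sum_nonneg mult_nonneg_nonneg) auto
    finally show ?thesis .
  qed
  show ?thesis
  proof (cases "\<exists>c d. \<eta> \<le> \<bar>y c d - x (s c) (s d)\<bar>")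
    case True
    then obtain c d where far: "\<eta> \<le> \<bar>y c d - x (s c) (s d)\<bar>" by blast
    have "\<beta>\<^sup>2 * \<eta>\<^sup>2 / 2 * real n * misfit n \<tau> (id \<circ> u) \<le> \<beta>\<^sup>2 * \<eta>\<^sup>2 / 2 * real n * real n"
      by (intro mult_left_mono misfit_bounds[OF \<tau>]) auto
    also have "\<dots> = \<beta> * real n * (m * \<eta>\<^sup>2)" by (simp add: m_def power2_eq_square)
    also have "\<dots> \<le> (\<Sum>i\<in>{i\<in>{1..n}. u i = c}. \<tau> i $ s c) * (m * \<eta>\<^sup>2)"
      using m0 by (intro mult_right_mono s) auto
    also have "\<dots> \<le> (\<Sum>i\<in>{i\<in>{1..n}. u i = c}. \<tau> i $ s c * C i (s c))"
      unfolding sum_distrib_right using far t(1) by (intro sum_mono mult_left_mono C[of _ d]) auto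
    also have "\<dots> \<le> (\<Sum>i\<in>{i\<in>{1..n}. u i = c}. \<Sum>a\<in>UNIV. \<tau> i $ a * C i a)"
      using C0 t(1) by (intro sum_mono member_le_sum[where f = "\<lambda>a. \<tau> _ $ a * C _ a"]) auto
    also have "\<dots> \<le> ?E"
      unfolding E using C0 t(1) by (intro sum_mono2 sum_nonneg mult_nonneg_nonneg) auto
    finally show ?thesis by (intro exI[of _ id]) simp
  next
    case False
    then have fit: "\<bar>y c d - x (s c) (s d)\<bar> < \<eta>" for c d by (meson not_le)
    have "inj s"
    proof (rule injI, rule ccontr)
      fix c e assume eq: "s c = s e" and "c \<noteq> e"
      then obtain d where "2 * \<eta> \<le> \<bar>y c d - y e d\<bar>" using gap by blast
      then show False using fit[of c d] fit[of e d] eq by auto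
    qed
    then have "bij s" by (simp add: bij_def finite_UNIV_inj_surj)
    have far: "m * \<eta>\<^sup>2 \<le> C i a" if i: "i \<in> {1..n}" and a: "a \<noteq> s (u i)" for i a
    proof -
      obtain e where e: "a = s e" using \<open>bij s\<close> by (metis bij_pointE)
      then obtain d where "2 * \<eta> \<le> \<bar>y (u i) d - y e d\<bar>" using gap[of "u i" e] a by blast
      then have "\<eta> \<le> \<bar>y (u i) d - x a (s d)\<bar>" using fit[of e d] e by auto
      then show ?thesis by (rule C[OF i])
    qed
    have "\<beta>\<^sup>2 * \<eta>\<^sup>2 / 2 * real n * misfit n \<tau> (s \<circ> u) = \<beta> * (m * \<eta>\<^sup>2 * misfit n \<tau> (s \<circ> u))"
      by (simp add: m_def power2_eq_square)
    also have "\<dots> \<le> 1 * (m * \<eta>\<^sup>2 * misfit n \<tau> (s \<circ> u))"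
      using \<beta>1 m0 misfit_bounds[OF \<tau>] by (intro mult_right_mono) auto
    also have "\<dots> = misfit n \<tau> (s \<circ> u) * (m * \<eta>\<^sup>2)" by simp
    also have "\<dots> = (\<Sum>i\<in>{1..n}. \<Sum>a\<in>UNIV - {s (u i)}. \<tau> i $ a * (m * \<eta>\<^sup>2))"
      by (simp only: misfit_eq_off_weight[OF \<tau>] sum_distrib_right comp_apply)
    also have "\<dots> \<le> (\<Sum>i\<in>{1..n}. \<Sum>a\<in>UNIV - {s (u i)}. \<tau> i $ a * C i a)"
      using t(1) by (intro sum_mono mult_left_mono far) auto
    also have "\<dots> \<le> ?E"
      unfolding E using C0 t(1) by (intro sum_mono sum_mono2 mult_nonneg_nonneg) auto
    finally show ?thesis using \<open>bij s\<close> by blast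
  qed
qed

lemma expected_hellinger2_ge:
  fixes u :: "nat \<Rightarrow> 'k::finite" and Q0 Q :: "real ^ 'k ^ 'k"
  assumes \<tau>: "\<tau> \<in> var_params n"
    and balanced: "\<And>c. \<gamma> * real n \<le> real (card {i\<in>{1..n}. u i = c})"
    and gap: "\<And>c e. c \<noteq> e \<Longrightarrow> \<exists>d. 2 * \<eta> \<le> \<bar>sqrt (Q0 $ c $ d) - sqrt (Q0 $ e $ d)\<bar>"
    and \<eta>: "0 < \<eta>" and \<beta>: "\<beta> = \<gamma> / real CARD('k)" and large: "2 \<le> \<beta> * real n"
    and P: "P = r *\<^sub>R Q0" "0 < r" "transpose P = P" "\<And>a b. 0 < P $ a $ b \<and> P $ a $ b < 1"
    and Q: "transpose Q = Q" "\<And>a b. 0 < Q $ a $ b \<and> Q $ a $ b < 1"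
  shows "\<exists>s. bij s \<and> \<beta>\<^sup>2 * \<eta>\<^sup>2 / 8 * (r * real n) * misfit n \<tau> (s \<circ> u) \<le>
    (\<Sum>z\<in>labelings n. var_prob n \<tau> z *
       (\<Sum>(i, j)\<in>node_pairs n. hellinger2 (P $ u i $ u j) (Q $ z i $ z j)))"
proof -
  define y where "y c d = sqrt (Q0 $ c $ d)" for c d
  define x where "x a b = sqrt (Q $ a $ b / r)" for a b
  define e where "e i j = (\<Sum>a\<in>UNIV. \<Sum>b\<in>UNIV. \<tau> i $ a * \<tau> j $ b * (y (u i) (u j) - x a b)\<^sup>2)" for i j
  have Qsym: "Q $ a $ b = Q $ b $ a" for a b using Q(1) by (simp add: transpose_def vec_eq_iff)
  have Psym: "P $ a $ b = P $ b $ a" for a b using P(3) by (simp add: transpose_def vec_eq_iff)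
  have Q0sym: "Q0 $ a $ b = Q0 $ b $ a" for a b using Psym[of a b] P(1,2) by simp
  have pt: "r / 2 * (y c d - x a b)\<^sup>2 \<le> hellinger2 (P $ c $ d) (Q $ a $ b)" for a b c d
  proof -
    have "sqrt r * y c d = sqrt (P $ c $ d)" by (simp add: P(1) y_def real_sqrt_mult)
    moreover have "sqrt r * x a b = sqrt (Q $ a $ b)" using P(2) by (simp add: x_def real_sqrt_divide)
    ultimately have "(sqrt r * (y c d - x a b))\<^sup>2 = (sqrt (P $ c $ d) - sqrt (Q $ a $ b))\<^sup>2"
      by (simp add: right_diff_distrib)
    then have "r * (y c d - x a b)\<^sup>2 = (sqrt (P $ c $ d) - sqrt (Q $ a $ b))\<^sup>2"
      using P(2) by (simp add: power_mult_distrib)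
    then show ?thesis
      using hellinger2_ge[of "P $ c $ d" "Q $ a $ b"] P(4)[of c d] Q(2)[of a b] by simp
  qed
  have ysym: "y c d = y d c" and xsym: "x c d = x d c" for c d
    using Q0sym[of c d] Qsym[of c d] by (simp_all add: y_def x_def)
  have esym: "e i j = e j i" for i j
    unfolding e_def
    by (subst sum.swap, intro sum.cong refl) (metis ysym xsym mult.commute)
  obtain s where s: "bij s" "\<beta>\<^sup>2 * \<eta>\<^sup>2 / 2 * real n * misfit n \<tau> (s \<circ> u) \<le>
      (\<Sum>i\<in>{1..n}. \<Sum>j\<in>{1..n} - {i}. e i j)"
    using soft_labeling_separation[OF \<tau> balanced _ \<eta> \<beta> large, of y x] gap
    unfolding e_def y_def by blast
  have "\<beta>\<^sup>2 * \<eta>\<^sup>2 / 8 * (r * real n) * misfit n \<tau> (s \<circ> u) =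
      r / 4 * (\<beta>\<^sup>2 * \<eta>\<^sup>2 / 2 * real n * misfit n \<tau> (s \<circ> u))" by simp
  also have "\<dots> \<le> r / 4 * (\<Sum>i\<in>{1..n}. \<Sum>j\<in>{1..n} - {i}. e i j)"
    using s(2) P(2) by (intro mult_left_mono) auto
  also have "\<dots> = r / 2 * (\<Sum>(i, j)\<in>node_pairs n. e i j)"
    using sum_node_pairs_symmetric[of e n, OF esym] by simp
  also have "\<dots> = (\<Sum>(i, j)\<in>node_pairs n. r / 2 * e i j)"
    by (simp only: sum_distrib_left case_prod_unfold)
  also have "\<dots> \<le> (\<Sum>(i, j)\<in>node_pairs n. \<Sum>z\<in>labelings n.
      var_prob n \<tau> z * hellinger2 (P $ u i $ u j) (Q $ z i $ z j))"
  proof (intro sum_mono, clarify)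
    fix i j assume "(i, j) \<in> node_pairs n"
    then have ij: "i \<in> {1..n}" "j \<in> {1..n}" "i \<noteq> j" by (auto simp: node_pairs_def)
    have "r / 2 * e i j = (\<Sum>a\<in>UNIV. \<Sum>b\<in>UNIV. \<tau> i $ a * \<tau> j $ b * (r / 2 * (y (u i) (u j) - x a b)\<^sup>2))"
      by (simp add: e_def sum_distrib_left mult_ac)
    also have "\<dots> \<le> (\<Sum>a\<in>UNIV. \<Sum>b\<in>UNIV. \<tau> i $ a * \<tau> j $ b * hellinger2 (P $ u i $ u j) (Q $ a $ b))"
      using var_params_nth(1)[OF \<tau>] ij by (intro sum_mono mult_left_mono pt mult_nonneg_nonneg) auto
    also have "\<dots> = (\<Sum>z\<in>labelings n. var_prob n \<tau> z * hellinger2 (P $ u i $ u j) (Q $ z i $ z j))"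
      by (rule var_prob_pair_marginal[OF \<tau> ij, symmetric])
    finally show "r / 2 * e i j \<le> \<dots>" .
  qed
  also have "\<dots> = (\<Sum>z\<in>labelings n. var_prob n \<tau> z *
       (\<Sum>(i, j)\<in>node_pairs n. hellinger2 (P $ u i $ u j) (Q $ z i $ z j)))"
    unfolding case_prod_unfold sum_distrib_left by (rule sum.swap)
  finally show ?thesis using s(1) by blast
qed


section \<open>Near-optimality of the two estimators\<close>

text \<open>The normalization of the posterior cancels the marginal likelihood. What remains is the expected
  log-likelihood minus the divergence of \<open>\<tau>\<close> from the product prior.\<close>

lemma var_objective_expand:
  fixes \<tau> :: "nat \<Rightarrow> real ^ 'k::finite"
  assumes \<theta>: "(\<alpha>, Q) \<in> param_set" and \<tau>: "\<tau> \<in> var_params n"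
  shows "var_objective n A \<tau> \<alpha> Q = (\<Sum>z\<in>labelings n. var_prob n \<tau> z * cond_loglik n A z Q) +
    (\<Sum>i\<in>{1..n}. \<Sum>a\<in>UNIV. \<tau> i $ a * (ln (\<alpha> $ a) - ln (\<tau> i $ a)))"
proof -
  let ?m = "ln (marginal_lik n A \<alpha> Q)"
  have \<alpha>: "0 < \<alpha> $ a" for a using \<theta> by (auto simp: param_set_iff)
  have "var_prob n \<tau> z * ln (var_prob n \<tau> z / posterior n A \<alpha> Q z) = var_prob n \<tau> z * ?m -
      var_prob n \<tau> z * cond_loglik n A z Q -
      (\<Sum>i\<in>{1..n}. var_prob n \<tau> z * (ln (\<alpha> $ z i) - ln (\<tau> i $ z i)))" for z
  proof (cases "var_prob n \<tau> z = 0")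
    case False
    have pos: "0 < \<tau> i $ z i" if "i \<in> {1..n}" for i
      using False that var_params_nth(1)[OF \<tau> that, of "z i"]
      by (auto simp: var_prob_def prod_zero_iff order_less_le)
    have 1: "ln (var_prob n \<tau> z) = (\<Sum>i\<in>{1..n}. ln (\<tau> i $ z i))" "0 < var_prob n \<tau> z"
      unfolding var_prob_def using pos by (force intro!: ln_prod prod_pos)+
    have 2: "ln (label_prior n \<alpha> z) = (\<Sum>i\<in>{1..n}. ln (\<alpha> $ z i))"
      unfolding label_prior_def using less_imp_neq[OF \<alpha>] by (intro ln_prod) (simp, metis)
    have "ln (posterior n A \<alpha> Q z) = (\<Sum>i\<in>{1..n}. ln (\<alpha> $ z i)) + cond_loglik n A z Q - ?m"
      unfolding posterior_def
      using label_prior_pos[OF \<theta>, of n z] marginal_lik_pos[OF \<theta>, of n A] by (simp add: ln_div ln_mult 2)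
    then have "ln (var_prob n \<tau> z / posterior n A \<alpha> Q z) =
        ?m - cond_loglik n A z Q - (\<Sum>i\<in>{1..n}. ln (\<alpha> $ z i) - ln (\<tau> i $ z i))"
      using 1 posterior_pos[OF \<theta>, of n A z] by (simp add: ln_div sum_subtractf)
    then show ?thesis by (simp add: right_diff_distrib sum_distrib_left)
  qed simp
  then have "var_objective n A \<tau> \<alpha> Q = ?m - ((\<Sum>z\<in>labelings n. var_prob n \<tau> z) * ?m -
      (\<Sum>z\<in>labelings n. var_prob n \<tau> z * cond_loglik n A z Q) -
      (\<Sum>z\<in>labelings n. \<Sum>i\<in>{1..n}. var_prob n \<tau> z * (ln (\<alpha> $ z i) - ln (\<tau> i $ z i))))"
    unfolding var_objective_eq[OF \<theta> \<tau>] by (simp only: sum_subtractf sum_distrib_right)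
  also have "(\<Sum>z\<in>labelings n. \<Sum>i\<in>{1..n}. var_prob n \<tau> z * (ln (\<alpha> $ z i) - ln (\<tau> i $ z i))) =
      (\<Sum>i\<in>{1..n}. \<Sum>z\<in>labelings n. var_prob n \<tau> z * (ln (\<alpha> $ z i) - ln (\<tau> i $ z i)))"
    by (rule sum.swap)
  also have "\<dots> = (\<Sum>i\<in>{1..n}. \<Sum>a\<in>UNIV. \<tau> i $ a * (ln (\<alpha> $ a) - ln (\<tau> i $ a)))"
    by (intro sum.cong refl var_prob_marginal[OF \<tau>, where f = "\<lambda>a. ln (\<alpha> $ a) - ln (\<tau> _ $ a)"])
  finally show ?thesis by (simp add: sum_var_prob[OF \<tau>])
qed

definition point_mass :: "nat \<Rightarrow> (nat \<Rightarrow> 'k::finite) \<Rightarrow> nat \<Rightarrow> real ^ 'k" where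
  "point_mass n v = (\<lambda>i\<in>{1..n}. axis (v i) 1)"

lemma point_mass_nth: "i \<in> {1..n} \<Longrightarrow> point_mass n v i $ a = of_bool (a = v i)"
  by (simp add: point_mass_def axis_def)

lemma point_mass_in_var_params: "point_mass n v \<in> var_params n"
  unfolding var_params_def point_mass_def prob_vecs_def
  by (intro restrict_PiE_iff[THEN iffD2] ballI) (simp add: axis_def)

lemma sum_var_prob_point_mass:
  fixes v :: "nat \<Rightarrow> 'k::finite"
  shows "(\<Sum>z\<in>labelings n. var_prob n (point_mass n v) z * f z) = f (restrict v {1..n})"
proof -
  have r: "restrict v {1..n} \<in> labelings n" by (simp add: labelings_def)
  have "var_prob n (point_mass n v) z = of_bool (z = restrict v {1..n})" if "z \<in> labelings n" for z
  proof (cases "z = restrict v {1..n}")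
    case False
    have "\<exists>i\<in>{1..n}. z i \<noteq> v i"
    proof (rule ccontr)
      assume "\<not> (\<exists>i\<in>{1..n}. z i \<noteq> v i)"
      then have "z i = restrict v {1..n} i" if "i \<in> {1..n}" for i
        using that by auto
      then have "z = restrict v {1..n}"
        by (rule PiE_ext[OF \<open>z \<in> labelings n\<close>[unfolded labelings_def] r[unfolded labelings_def]])
      then show False using False by contradiction
    qed
    then obtain i where i: "i \<in> {1..n}" "z i \<noteq> v i" by blast
    then have "point_mass n v i $ z i = 0" by (simp add: point_mass_nth)
    then have "var_prob n (point_mass n v) z = 0"
      unfolding var_prob_def using i by (intro prod_zero) auto
    then show ?thesis using False by simp
  qed (auto simp: var_prob_def point_mass_nth)
  then have "(\<Sum>z\<in>labelings n. var_prob n (point_mass n v) z * f z) =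
      (\<Sum>z\<in>labelings n. if z = restrict v {1..n} then f z else 0)"
    by (intro sum.cong) auto
  also have "\<dots> = f (restrict v {1..n})"
    using r by (simp add: finite_labelings)
  finally show ?thesis .
qed

lemma cond_loglik_cong:
  assumes "\<And>i j. (i, j) \<in> node_pairs n \<Longrightarrow> Q $ z i $ z j = Q' $ z' i $ z' j"
  shows "cond_loglik n A z Q = cond_loglik n A z' Q'"
  unfolding cond_loglik_def using assms by (intro sum.cong refl) (auto simp: case_prod_unfold)

lemma cond_loglik_restrict: "cond_loglik n A (restrict v {1..n}) Q = cond_loglik n A v Q"
  by (rule cond_loglik_cong) (auto simp: node_pairs_def)

lemma one_le_ln_of_three_le: "3 \<le> n \<Longrightarrow> 1 \<le> ln (real n)"
proof -
  assume "3 \<le> n"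
  then have "exp 1 \<le> real n" "0 < real n" using exp_le by linarith+
  then show ?thesis by (simp add: ln_ge_iff)
qed

text \<open>Against the point mass at \<open>c\<close>, the entropy of a probability vector and the change of the
  prior term together gain only a logarithm per unit of weight that is moved away from \<open>c\<close>, and a remainder that sums to
  a constant over the nodes.\<close>

lemma entropy_gain_le:
  fixes t \<alpha> :: "'k::finite \<Rightarrow> real"
  assumes t: "\<And>a. 0 \<le> t a" "(\<Sum>a\<in>UNIV. t a) = 1"
    and \<alpha>: "\<And>a. 1 / (real n * real CARD('k)) \<le> \<alpha> a" "\<And>a. \<alpha> a \<le> 1"
    and n: "3 \<le> n" "CARD('k) \<le> n"
  shows "(\<Sum>a\<in>UNIV. t a * (ln (\<alpha> a) - ln (t a))) \<le>
    ln (\<alpha> c) + 4 * ln (real n) * (1 - t c) + real CARD('k) / real n"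
proof -
  have k: "0 < real CARD('k)" and n0: "0 < real n" using n by auto
  have \<alpha>0: "0 < \<alpha> a" for a
    using \<alpha>(1)[of a] k n0 by (meson divide_pos_pos less_le_trans mult_pos_pos zero_less_one)
  have ln1: "1 \<le> ln (real n)" using n(1) by (rule one_le_ln_of_three_le)
  have tc: "t c \<le> 1" using member_le_sum[of c UNIV t] t by simp
  have split: "(\<Sum>a\<in>UNIV. f a) = f c + (\<Sum>a\<in>UNIV - {c}. f a)" for f :: "'k \<Rightarrow> real"
    by (rule sum.remove) auto
  have rest: "(\<Sum>a\<in>UNIV - {c}. t a) = 1 - t c" using split[of t] t by simp
  have other: "t a * (ln (\<alpha> a) - ln (t a)) \<le> t a * ln (real n) + 1 / real n" for a
  proof (cases "t a = 0")
    case False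
    then have ta: "0 < t a" using t(1)[of a] by simp
    have "ln (\<alpha> a) \<le> 0" using \<alpha>(2)[of a] \<alpha>0[of a] by simp
    then have "t a * (ln (\<alpha> a) - ln (t a)) \<le> t a * (ln (real n) + ln (1 / (real n * t a)))"
      using ta n0 by (intro mult_left_mono) (auto simp: ln_div ln_mult)
    also have "\<dots> \<le> t a * (ln (real n) + (1 / (real n * t a) - 1))"
      using ta n0 by (intro mult_left_mono add_left_mono ln_le_minus_one) auto
    also have "\<dots> = t a * ln (real n) + 1 / real n - t a"
      using ta n0 by (simp add: field_simps)
    finally show ?thesis using ta by simp
  qed (use n0 in simp)
  have own: "t c * (ln (\<alpha> c) - ln (t c)) \<le> ln (\<alpha> c) + (1 - t c) * (2 * ln (real n)) + (1 - t c)"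
  proof -
    have "- t c * ln (t c) \<le> 1 - t c"
    proof (cases "t c = 0")
      case False
      then have "0 < t c" using t(1)[of c] by simp
      then have "t c * ln (1 / t c) \<le> t c * (1 / t c - 1)"
        by (intro mult_left_mono ln_le_minus_one) auto
      then show ?thesis using \<open>0 < t c\<close> by (simp add: ln_div right_diff_distrib)
    qed simp
    moreover have "(1 - t c) * (- ln (\<alpha> c)) \<le> (1 - t c) * (2 * ln (real n))"
    proof (intro mult_left_mono)
      have "- ln (\<alpha> c) = ln (1 / \<alpha> c)" using \<alpha>0[of c] by (simp add: ln_div)
      also have "\<dots> \<le> ln (real n * real n)"
      proof (subst ln_le_cancel_iff)
        have "1 / (real n * real n) \<le> 1 / (real n * real CARD('k))"
          using n n0 k by (intro divide_left_mono mult_left_mono) auto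
        then have "1 / (real n * real n) \<le> \<alpha> c" using \<alpha>(1)[of c] by linarith
        then show "1 / \<alpha> c \<le> real n * real n" using \<alpha>0[of c] n0 by (simp add: divide_le_eq mult.commute)
      qed (use \<alpha>0 n0 in auto)
      finally show "- ln (\<alpha> c) \<le> 2 * ln (real n)" using n0 by (simp add: ln_mult)
    qed (use tc in simp)
    ultimately show ?thesis by (simp add: algebra_simps)
  qed
  have "(\<Sum>a\<in>UNIV. t a * (ln (\<alpha> a) - ln (t a))) \<le>
      ln (\<alpha> c) + (1 - t c) * (2 * ln (real n)) + (1 - t c) +
      (\<Sum>a\<in>UNIV - {c}. t a * ln (real n) + 1 / real n)"
    unfolding split[of "\<lambda>a. t a * (ln (\<alpha> a) - ln (t a))"] by (intro add_mono own sum_mono other)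
  also have "(\<Sum>a\<in>UNIV - {c}. t a * ln (real n) + 1 / real n) =
      (1 - t c) * ln (real n) + real (card (UNIV - {c})) / real n"
    by (simp add: sum.distrib sum_distrib_right[symmetric] rest)
  also have "real (card (UNIV - {c})) / real n \<le> real CARD('k) / real n"
    using n0 by (intro divide_right_mono of_nat_mono card_mono) auto
  also have "ln (\<alpha> c) + (1 - t c) * (2 * ln (real n)) + (1 - t c) +
      ((1 - t c) * ln (real n) + real CARD('k) / real n) \<le>
      ln (\<alpha> c) + 4 * ln (real n) * (1 - t c) + real CARD('k) / real n"
    using mult_left_mono[OF ln1, of "1 - t c"] tc by (simp add: algebra_simps)
  finally show ?thesis by simp
qed

text \<open>The common consequence of optimality for both estimators: in expected log-likelihood, the
  soft labeling does as well as the truth up to a logarithm per unit of misfit and one further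
  logarithm, for every choice of the relabeling.\<close>

definition nearly_optimal ::
    "nat \<Rightarrow> (nat \<Rightarrow> nat \<Rightarrow> real) \<Rightarrow> real ^ 'k::finite ^ 'k \<Rightarrow> (nat \<Rightarrow> 'k) \<Rightarrow>
     (nat \<Rightarrow> real ^ 'k) \<Rightarrow> real ^ 'k ^ 'k \<Rightarrow> bool" where
  "nearly_optimal n A P u \<tau> Q \<longleftrightarrow>
     transpose Q = Q \<and> (\<forall>a b. 0 < Q $ a $ b \<and> Q $ a $ b < 1) \<and> (\<forall>s. bij s \<longrightarrow>
       cond_loglik n A u P \<le> (\<Sum>z\<in>labelings n. var_prob n \<tau> z * cond_loglik n A z Q) +
         (real CARD('k) + 4) * ((misfit n \<tau> (s \<circ> u) + 1) * ln (real n)))"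

lemma uniform_prob_vec: "(\<chi> a. 1 / real CARD('k)) \<in> (prob_vecs :: (real ^ 'k::finite) set)"
  by (simp add: prob_vecs_def)

lemma conn_matrices_iff:
  "Q \<in> conn_matrices \<longleftrightarrow> transpose Q = Q \<and> (\<forall>a b. 0 < Q $ a $ b \<and> Q $ a $ b < 1)"
  for Q :: "real ^ 'k::finite ^ 'k"
proof -
  have "\<forall>a. 0 < (\<chi> a. 1 / real CARD('k) :: real ^ 'k) $ a" by simp
  then show ?thesis
    unfolding conn_matrices_def param_set_iff mem_Collect_eq using uniform_prob_vec by blast
qed

lemma sum_bernoulli_kl_eq:
  assumes "\<And>i j. A i j \<in> {0, 1}"
  shows "(\<Sum>(i, j)\<in>node_pairs n. bernoulli_kl (A i j) (Q $ z i $ z j)) = - cond_loglik n A z Q"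
proof -
  have "bernoulli_kl x q = - (x * ln q + (1 - x) * ln (1 - q))" if "x \<in> {0, 1}" for x q
    using that by (auto simp: bernoulli_kl_def ln_div)
  then show ?thesis
    using assms unfolding cond_loglik_def sum_negf[symmetric] case_prod_unfold
    by (intro sum.cong refl) blast
qed

lemma profile_labeling_nearly_optimal:
  fixes P :: "real ^ 'k::finite ^ 'k"
  assumes opt: "is_profile_labeling n A z" and A: "\<And>i j. A i j \<in> {0, 1}"
    and P: "P \<in> conn_matrices" and u: "u \<in> labelings n" and n: "1 \<le> n"
  shows "\<exists>Q. nearly_optimal n A P u (point_mass n z) Q"
proof -
  define f where "f = (\<lambda>(Q :: real ^ 'k ^ 'k, z). \<Sum>(i, j)\<in>node_pairs n. bernoulli_kl (A i j) (Q $ z i $ z j))"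
  define C where "C = (\<lambda>(Q :: real ^ 'k ^ 'k, z :: nat \<Rightarrow> 'k). Q \<in> conn_matrices \<and> z \<in> labelings n)"
  obtain Q where opt_Q: "is_arg_min f C (Q, z)"
    using opt unfolding is_profile_labeling_def f_def C_def by blast
  then have Q: "Q \<in> conn_matrices" by (simp add: is_arg_min_def C_def)
  have f: "f (Q, z) = - cond_loglik n A z Q" for Q z
    by (simp add: f_def sum_bernoulli_kl_eq[of A, OF A])
  have "C (P, u)" using P u by (simp add: C_def)
  then have "\<not> f (P, u) < f (Q, z)"
    using opt_Q unfolding is_arg_min_def by blast
  then have "cond_loglik n A u P \<le> cond_loglik n A z Q" by (simp add: f)
  moreover have "0 \<le> (real CARD('k) + 4) * ((misfit n (point_mass n z) (s \<circ> u) + 1) * ln (real n))" for s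
    using n misfit_bounds(1)[OF point_mass_in_var_params[of n z], of "s \<circ> u"] by simp
  ultimately have "nearly_optimal n A P u (point_mass n z) Q"
    unfolding nearly_optimal_def sum_var_prob_point_mass cond_loglik_restrict
    using Q by (simp add: conn_matrices_iff add_increasing2)
  then show ?thesis ..
qed

text \<open>The maximizer is compared with the point mass at the relabeled truth. Mixing the estimated
  community proportions with the uniform distribution lowers the objective by at most a constant, and
  it keeps the prior cost of the relabeled truth logarithmic per node.\<close>

lemma var_labeling_nearly_optimal:
  fixes P :: "real ^ 'k::finite ^ 'k"
  assumes opt: "is_var_labeling n A z"
    and P: "P \<in> conn_matrices" and n: "3 \<le> n" "CARD('k) \<le> n"
  shows "\<exists>Q \<tau>. \<tau> \<in> var_params n \<and> nearly_optimal n A P u \<tau> Q \<and> (\<forall>i\<in>{1..n}. \<forall>a. \<tau> i $ a \<le> \<tau> i $ z i)"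
proof -
  define f where "f = (\<lambda>(\<alpha> :: real ^ 'k, Q :: real ^ 'k ^ 'k, \<tau> :: nat \<Rightarrow> real ^ 'k). var_objective n A \<tau> \<alpha> Q)"
  define C where "C = (\<lambda>(\<alpha> :: real ^ 'k, Q :: real ^ 'k ^ 'k, \<tau> :: nat \<Rightarrow> real ^ 'k). (\<alpha>, Q) \<in> param_set \<and> \<tau> \<in> var_params n)"
  obtain \<alpha> Q \<tau> where opt': "is_arg_max f C (\<alpha>, Q, \<tau>)"
    and z': "\<forall>i\<in>{1..n}. is_arg_max (\<lambda>a. \<tau> i $ a) (\<lambda>_. True) (z i)"
    using opt unfolding is_var_labeling_def f_def C_def by blast
  have \<theta>: "(\<alpha>, Q) \<in> param_set" and \<tau>: "\<tau> \<in> var_params n"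
    using opt' by (simp_all add: is_arg_max_def C_def)
  have max: "var_objective n A \<tau>' \<alpha>' Q' \<le> var_objective n A \<tau> \<alpha> Q"
    if "(\<alpha>', Q') \<in> param_set" "\<tau>' \<in> var_params n" for \<alpha>' and Q' :: "real ^ 'k ^ 'k" and \<tau>'
  proof -
    have "C (\<alpha>', Q', \<tau>')" using that by (simp add: C_def)
    then have "\<not> f (\<alpha>, Q, \<tau>) < f (\<alpha>', Q', \<tau>')"
      using opt' unfolding is_arg_max_def by blast
    then show ?thesis by (simp add: f_def)
  qed
  have z: "\<forall>i\<in>{1..n}. \<forall>a. \<tau> i $ a \<le> \<tau> i $ z i"
    using z' by (auto simp: is_arg_max_def not_less)
  note t = var_params_nth[OF \<tau>]
  have n0: "0 < real n" and ln1: "1 \<le> ln (real n)"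
    using n(1) one_le_ln_of_three_le by auto
  have \<alpha>: "\<alpha> \<in> prob_vecs" "\<And>a. 0 < \<alpha> $ a" using \<theta> by (auto simp: param_set_iff)
  have \<alpha>_le: "\<alpha> $ a \<le> 1" for a
    using member_le_sum[of a UNIV "\<lambda>a. \<alpha> $ a"] \<alpha> by (auto simp: prob_vecs_def)
  define k where "k = real CARD('k)"
  have k: "1 \<le> k" unfolding k_def by (simp add: Suc_le_eq)
  define \<alpha>' :: "real ^ 'k" where "\<alpha>' = (\<chi> a. (1 - 1 / real n) * \<alpha> $ a + 1 / (real n * k))"
  have n1: "0 < 1 - 1 / real n" using n by simp
  have \<alpha>'_pos: "0 < \<alpha>' $ a" for a
    using n1 \<alpha>(2)[of a] n0 k by (simp add: \<alpha>'_def add_pos_pos)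
  have \<alpha>'_ge: "1 / (real n * real CARD('k)) \<le> \<alpha>' $ a" for a
    using n1 \<alpha>(2)[of a] by (simp add: \<alpha>'_def k_def)
  have \<alpha>'_sum: "(\<Sum>a\<in>UNIV. \<alpha>' $ a) = 1"
  proof -
    have "(\<Sum>a\<in>UNIV. \<alpha>' $ a) = (1 - 1 / real n) * (\<Sum>a\<in>UNIV. \<alpha> $ a) + k * (1 / (real n * k))"
      by (simp add: \<alpha>'_def sum.distrib sum_distrib_left k_def)
    then show ?thesis using \<alpha>(1) k n0 by (simp add: prob_vecs_def)
  qed
  have \<alpha>'_le: "\<alpha>' $ a \<le> 1" for a
    using member_le_sum[of a UNIV "\<lambda>a. \<alpha>' $ a"] \<alpha>'_pos \<alpha>'_sum by (simp add: less_imp_le)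
  have ln_\<alpha>: "ln (\<alpha> $ a) \<le> ln (\<alpha>' $ a) + 2 / real n" for a
  proof -
    have "ln (1 / (1 - 1 / real n)) \<le> 1 / (1 - 1 / real n) - 1"
      using n1 by (intro ln_le_minus_one) auto
    also have "\<dots> = 1 / (real n - 1)" using n by (simp add: field_simps)
    also have "\<dots> \<le> 2 / real n" using n by (simp add: field_simps)
    finally have "- ln (1 - 1 / real n) \<le> 2 / real n"
      using n1 by (simp only: inverse_eq_divide[symmetric] ln_inverse)
    moreover have "ln ((1 - 1 / real n) * \<alpha> $ a) \<le> ln (\<alpha>' $ a)"
      using n1 \<alpha>(2)[of a] \<alpha>'_pos[of a] n0 k by (subst ln_le_cancel_iff) (auto simp: \<alpha>'_def)
    moreover have "n \<noteq> Suc 0" using n by simp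
    ultimately show ?thesis using n1 \<alpha>(2)[of a] by (simp add: ln_mult)
  qed
  have "cond_loglik n A u P \<le> (\<Sum>z\<in>labelings n. var_prob n \<tau> z * cond_loglik n A z Q) +
      (k + 4) * ((misfit n \<tau> (s \<circ> u) + 1) * ln (real n))" if s: "bij s" for s
  proof -
    define W where "W = misfit n \<tau> (s \<circ> u)"
    define EL where "EL = (\<Sum>z\<in>labelings n. var_prob n \<tau> z * cond_loglik n A z Q)"
    define P' :: "real ^ 'k ^ 'k" where "P' = (\<chi> a b. P $ (inv s a) $ (inv s b))"
    have inv_s: "inv s (s a) = a" for a using s by (simp add: bij_is_inj)
    have "P $ a $ b = P $ b $ a" for a b using P by (simp add: conn_matrices_iff transpose_def vec_eq_iff)
    then have P': "(\<alpha>', P') \<in> param_set"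
      using P \<alpha>'_pos \<alpha>'_sum
      by (simp add: param_set_iff conn_matrices_iff prob_vecs_def P'_def transpose_def vec_eq_iff less_imp_le)
    have "cond_loglik n A u P + (\<Sum>i\<in>{1..n}. ln (\<alpha>' $ s (u i))) =
        cond_loglik n A (s \<circ> u) P' + (\<Sum>i\<in>{1..n}. \<Sum>a\<in>UNIV. point_mass n (s \<circ> u) i $ a *
           (ln (\<alpha>' $ a) - ln (point_mass n (s \<circ> u) i $ a)))"
    proof -
      have "cond_loglik n A u P = cond_loglik n A (s \<circ> u) P'"
        by (rule cond_loglik_cong) (simp add: P'_def inv_s)
      moreover have "(\<Sum>a\<in>UNIV. point_mass n (s \<circ> u) i $ a *
          (ln (\<alpha>' $ a) - ln (point_mass n (s \<circ> u) i $ a))) = ln (\<alpha>' $ s (u i))" if "i \<in> {1..n}" for i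
      proof -
        have "(\<Sum>a\<in>UNIV. point_mass n (s \<circ> u) i $ a *
            (ln (\<alpha>' $ a) - ln (point_mass n (s \<circ> u) i $ a))) =
            (\<Sum>a\<in>UNIV. if a = s (u i) then ln (\<alpha>' $ a) else 0)"
          by (intro sum.cong refl) (simp add: point_mass_nth[OF that])
        then show ?thesis by simp
      qed
      ultimately show ?thesis by simp
    qed
    also have "\<dots> = var_objective n A (point_mass n (s \<circ> u)) \<alpha>' P'"
      unfolding var_objective_expand[OF P' point_mass_in_var_params] sum_var_prob_point_mass
        cond_loglik_restrict ..
    also have "\<dots> \<le> var_objective n A \<tau> \<alpha> Q"
      by (rule max[OF P' point_mass_in_var_params])
    also have "\<dots> = EL + (\<Sum>i\<in>{1..n}. \<Sum>a\<in>UNIV. \<tau> i $ a * (ln (\<alpha> $ a) - ln (\<tau> i $ a)))"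
      unfolding var_objective_expand[OF \<theta> \<tau>] EL_def ..
    also have "\<dots> \<le> EL + (\<Sum>i\<in>{1..n}. ln (\<alpha>' $ s (u i)) + 4 * ln (real n) * (1 - \<tau> i $ s (u i)) +
        k / real n + 2 / real n)"
    proof (intro add_left_mono sum_mono)
      fix i assume i: "i \<in> {1..n}"
      have "(\<Sum>a\<in>UNIV. \<tau> i $ a * (ln (\<alpha> $ a) - ln (\<tau> i $ a))) \<le>
          (\<Sum>a\<in>UNIV. \<tau> i $ a * ((ln (\<alpha>' $ a) - ln (\<tau> i $ a)) + 2 / real n))"
        using t(1)[OF i] ln_\<alpha> by (intro sum_mono mult_left_mono) (auto simp: algebra_simps)
      also have "\<dots> = (\<Sum>a\<in>UNIV. \<tau> i $ a * (ln (\<alpha>' $ a) - ln (\<tau> i $ a))) + (\<Sum>a\<in>UNIV. \<tau> i $ a) * (2 / real n)"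
        by (simp only: distrib_left sum.distrib sum_distrib_right)
      also have "\<dots> \<le> ln (\<alpha>' $ s (u i)) + 4 * ln (real n) * (1 - \<tau> i $ s (u i)) +
          real CARD('k) / real n + (\<Sum>a\<in>UNIV. \<tau> i $ a) * (2 / real n)"
        by (intro add_right_mono entropy_gain_le t(1,2)[OF i] \<alpha>'_ge \<alpha>'_le n)
      finally show "(\<Sum>a\<in>UNIV. \<tau> i $ a * (ln (\<alpha> $ a) - ln (\<tau> i $ a))) \<le> ln (\<alpha>' $ s (u i)) +
          4 * ln (real n) * (1 - \<tau> i $ s (u i)) + k / real n + 2 / real n"
        by (simp add: t(2)[OF i] k_def)
    qed
    also have "\<dots> = EL + (\<Sum>i\<in>{1..n}. ln (\<alpha>' $ s (u i))) + 4 * ln (real n) * W + k + 2"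
      using n0 by (simp add: sum.distrib W_def misfit_def sum_distrib_left[symmetric] del: sum_subtractf sum_constant_scale)
    finally have "cond_loglik n A u P \<le> EL + (4 * ln (real n) * W + k + 2)" by simp
    also have "4 * ln (real n) * W + k + 2 \<le> (k + 4) * ((W + 1) * ln (real n))"
    proof -
      have "0 \<le> W" unfolding W_def by (rule misfit_bounds[OF \<tau>])
      then have "4 * (ln (real n) * W) \<le> (k + 4) * (ln (real n) * W)"
        using k ln1 by (intro mult_right_mono) auto
      moreover have "(k + 4) * 1 \<le> (k + 4) * ln (real n)" using k ln1 by (intro mult_left_mono) auto
      ultimately show ?thesis by (simp add: algebra_simps)
    qed
    finally show ?thesis by (simp add: EL_def W_def)
  qed
  then have "nearly_optimal n A P u \<tau> Q"
    using \<theta> by (simp add: nearly_optimal_def param_set_iff k_def)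
  then show ?thesis using \<tau> z by blast
qed


section \<open>Exact recovery on the typical event\<close>

text \<open>A nearly optimal soft labeling loses at least of order \<open>r * n\<close> per unit of misfit, by
  separation, and regains only of order \<open>ln n\<close> per unit, plus one such amount overall. So its
  total misfit is small, and no single node can be wrong.\<close>

lemma nearly_optimal_recovers:
  fixes u :: "nat \<Rightarrow> 'k::finite" and Q0 Q :: "real ^ 'k ^ 'k"
  assumes \<tau>: "\<tau> \<in> var_params n" and opt: "nearly_optimal n A P u \<tau> Q"
    and A: "\<And>i j. A i j \<in> {0, 1}" and typical: "typical_adjacency n P u K A"
    and balanced: "\<And>c. \<gamma> * real n \<le> real (card {i\<in>{1..n}. u i = c})"
    and gap: "\<And>c e. c \<noteq> e \<Longrightarrow> \<exists>d. 2 * \<eta> \<le> \<bar>sqrt (Q0 $ c $ d) - sqrt (Q0 $ e $ d)\<bar>"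
    and \<eta>: "0 < \<eta>" and \<beta>: "\<beta> = \<gamma> / real CARD('k)" and large: "2 \<le> \<beta> * real n" "3 \<le> n"
    and P: "P = r *\<^sub>R Q0" "0 < r" "P \<in> conn_matrices" and K: "0 \<le> K"
    and signal: "(14 + 6 * K + 3 * real CARD('k)) * ln (real n) < \<beta>\<^sup>2 * \<eta>\<^sup>2 / 4 * (r * real n)"
  shows "\<exists>s. bij s \<and> (\<forall>i\<in>{1..n}. 1 / 2 < \<tau> i $ s (u i))"
proof -
  define l where "l = ln (real n)"
  have l: "1 \<le> l" unfolding l_def using large(2) by (rule one_le_ln_of_three_le)
  have P01: "transpose P = P" "0 < P $ a $ b \<and> P $ a $ b < 1" for a b
    using P(3) by (auto simp: conn_matrices_iff)
  have Qsym: "transpose Q = Q" and Q01: "0 < Q $ a $ b" "Q $ a $ b < 1" for a b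
    using opt by (auto simp: nearly_optimal_def)
  obtain Q' where Q': "Q' \<in> grid n" "transpose Q' = Q'"
    and Q'_le: "\<And>z. cond_loglik n A z Q \<le> cond_loglik n A z Q' + 1"
    using cond_loglik_le_grid[OF Q01 Qsym, of n] A large by auto
  define EL where "EL Q = (\<Sum>z\<in>labelings n. var_prob n \<tau> z * cond_loglik n A z Q)" for Q
  define H where "H z = (\<Sum>(i, j)\<in>node_pairs n. hellinger2 (P $ u i $ u j) (Q' $ z i $ z j))" for z
  define EH where "EH = (\<Sum>z\<in>labelings n. var_prob n \<tau> z * H z)"
  obtain s where s: "bij s" and sep: "\<beta>\<^sup>2 * \<eta>\<^sup>2 / 8 * (r * real n) * misfit n \<tau> (s \<circ> u) \<le> EH"
    using expected_hellinger2_ge[OF \<tau> balanced gap \<eta> \<beta> large(1) P(1,2) P01 Q'(2)] grid_bounds[OF Q'(1)]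
    unfolding EH_def H_def by blast
  define W where "W = misfit n \<tau> (s \<circ> u)"
  have W0: "0 \<le> W" unfolding W_def by (rule misfit_bounds[OF \<tau>])
  have vp0: "0 \<le> var_prob n \<tau> z" for z by (rule var_prob_nonneg[OF \<tau>])
  note vp1 = sum_var_prob[OF \<tau>]
  have "EL Q \<le> (\<Sum>z\<in>labelings n. var_prob n \<tau> z * (cond_loglik n A z Q' + 1))"
    unfolding EL_def using Q'_le vp0 by (intro sum_mono mult_left_mono) auto
  also have "\<dots> = EL Q' + 1"
    by (simp add: distrib_left sum.distrib vp1 EL_def)
  finally have round: "EL Q \<le> EL Q' + 1" .
  have "EL Q' + 2 * EH = (\<Sum>z\<in>labelings n. var_prob n \<tau> z * (cond_loglik n A z Q' + 2 * H z))"
    by (simp add: EL_def EH_def distrib_left sum.distrib sum_distrib_left mult.left_commute)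
  also have "\<dots> \<le> (\<Sum>z\<in>labelings n. var_prob n \<tau> z *
      (cond_loglik n A u P + 2 * (K * ((disagreements n z (s \<circ> u) + 1) * l))))"
    using typical Q'(1) vp0 unfolding typical_adjacency_def H_def l_def
    by (intro sum_mono mult_left_mono) auto
  also have "\<dots> = (\<Sum>z\<in>labelings n. var_prob n \<tau> z * (cond_loglik n A u P + 2 * K * l) +
      (var_prob n \<tau> z * disagreements n z (s \<circ> u)) * (2 * K * l))"
    by (intro sum.cong refl) (simp add: algebra_simps)
  also have "\<dots> = (\<Sum>z\<in>labelings n. var_prob n \<tau> z) * (cond_loglik n A u P + 2 * K * l) +
      (\<Sum>z\<in>labelings n. var_prob n \<tau> z * disagreements n z (s \<circ> u)) * (2 * K * l)"
    by (simp only: sum.distrib sum_distrib_right)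
  also have "\<dots> = cond_loglik n A u P + 2 * K * ((W + 1) * l)"
    unfolding vp1 expected_disagreements[OF \<tau>] W_def[symmetric] by (simp add: algebra_simps)
  finally have upper: "EL Q' + 2 * EH \<le> cond_loglik n A u P + 2 * K * ((W + 1) * l)" .
  have "cond_loglik n A u P \<le> EL Q + (real CARD('k) + 4) * ((W + 1) * l)"
    using opt s unfolding nearly_optimal_def EL_def W_def l_def by blast
  with upper round have "2 * EH \<le> 1 + (2 * K + real CARD('k) + 4) * ((W + 1) * l)"
    by (simp add: algebra_simps)
  then have main: "\<beta>\<^sup>2 * \<eta>\<^sup>2 / 4 * (r * real n) * W \<le> 1 + (2 * K + real CARD('k) + 4) * ((W + 1) * l)"
    using sep unfolding W_def by simp
  have "W < 1 / 2"
  proof (rule ccontr)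
    assume "\<not> W < 1 / 2"
    then have W: "1 / 2 \<le> W" by simp
    \<comment> \<open>Then \<open>1 \<le> 2 * W * l\<close> and \<open>W + 1 \<le> 3 * W\<close>; the constant in \<open>signal\<close> is
        \<open>2 + 3 * (2 * K + CARD('k) + 4)\<close>.\<close>
    have "1 * 1 \<le> (2 * W) * l" using W l by (intro mult_mono) auto
    moreover have "(2 * K + real CARD('k) + 4) * ((W + 1) * l) \<le> (2 * K + real CARD('k) + 4) * ((3 * W) * l)"
      using W l K by (intro mult_left_mono mult_right_mono) auto
    ultimately have "1 + (2 * K + real CARD('k) + 4) * ((W + 1) * l) \<le>
        (14 + 6 * K + 3 * real CARD('k)) * l * W"
      by (simp add: algebra_simps)
    also have "\<dots> < \<beta>\<^sup>2 * \<eta>\<^sup>2 / 4 * (r * real n) * W"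
      using signal W unfolding l_def by (intro mult_strict_right_mono) auto
    finally show False using main by simp
  qed
  then have "1 / 2 < \<tau> i $ s (u i)" if "i \<in> {1..n}" for i
    using node_weight_le_misfit[OF \<tau> that, of "s \<circ> u"] by (simp add: W_def)
  then show ?thesis using s by blast
qed

lemma relabel_equiv_of_common_source:
  assumes "bij s" "bij s'" and "\<And>i. i \<in> {1..n} \<Longrightarrow> z i = s (u i)" "\<And>i. i \<in> {1..n} \<Longrightarrow> z' i = s' (u i)"
  shows "relabel_equiv n z z'"
  unfolding relabel_equiv_def
proof (intro exI conjI ballI)
  show "bij (s' \<circ> inv s)" using assms by (intro bij_comp bij_imp_bij_inv)
  show "z' i = (s' \<circ> inv s) (z i)" if "i \<in> {1..n}" for i
    using assms that by (simp add: bij_is_inj)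
qed

lemma estimators_agree_on_typical_event:
  fixes u zv zp :: "nat \<Rightarrow> 'k::finite" and Q0 :: "real ^ 'k ^ 'k"
  assumes A: "\<And>i j. A i j \<in> {0, 1}" and u: "u \<in> labelings n" and typical: "typical_adjacency n P u K A"
    and balanced: "\<And>c. \<gamma> * real n \<le> real (card {i\<in>{1..n}. u i = c})"
    and gap: "\<And>c e. c \<noteq> e \<Longrightarrow> \<exists>d. 2 * \<eta> \<le> \<bar>sqrt (Q0 $ c $ d) - sqrt (Q0 $ e $ d)\<bar>"
    and \<eta>: "0 < \<eta>" and \<beta>: "\<beta> = \<gamma> / real CARD('k)"
    and large: "2 \<le> \<beta> * real n" "3 \<le> n" "CARD('k) \<le> n"
    and P: "P = r *\<^sub>R Q0" "0 < r" "P \<in> conn_matrices" and K: "0 \<le> K"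
    and signal: "(14 + 6 * K + 3 * real CARD('k)) * ln (real n) < \<beta>\<^sup>2 * \<eta>\<^sup>2 / 4 * (r * real n)"
    and zv: "is_var_labeling n A zv" and zp: "is_profile_labeling n A zp"
  shows "relabel_equiv n zv zp"
proof -
  note rec = nearly_optimal_recovers[OF _ _ A typical balanced gap \<eta> \<beta> large(1,2) P K signal]
  obtain Q where "nearly_optimal n A P u (point_mass n zp) Q"
    using profile_labeling_nearly_optimal[OF zp A P(3) u] large(2) by auto
  then obtain s' where s': "bij s'" "\<forall>i\<in>{1..n}. 1 / 2 < point_mass n zp i $ s' (u i)"
    using rec[OF point_mass_in_var_params] by blast
  have p: "zp i = s' (u i)" if "i \<in> {1..n}" for i
    using s'(2) that by (auto simp: point_mass_nth of_bool_def split: if_splits)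
  obtain Q \<tau> where \<tau>: "\<tau> \<in> var_params n" and opt: "nearly_optimal n A P u \<tau> Q"
    and max: "\<forall>i\<in>{1..n}. \<forall>a. \<tau> i $ a \<le> \<tau> i $ zv i"
    using var_labeling_nearly_optimal[OF zv P(3) large(2,3)] by blast
  obtain s where s: "bij s" "\<forall>i\<in>{1..n}. 1 / 2 < \<tau> i $ s (u i)"
    using rec[OF \<tau> opt] by blast
  have v: "zv i = s (u i)" if i: "i \<in> {1..n}" for i
  proof (rule ccontr)
    assume "zv i \<noteq> s (u i)"
    then have "\<tau> i $ zv i + \<tau> i $ s (u i) = (\<Sum>a\<in>{zv i, s (u i)}. \<tau> i $ a)" by simp
    also have "\<dots> \<le> (\<Sum>a\<in>UNIV. \<tau> i $ a)" using var_params_nth(1)[OF \<tau> i] by (intro sum_mono2) auto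
    also have "\<dots> = 1" by (rule var_params_nth(2)[OF \<tau> i])
    finally show False using s(2) max i by (smt (verit, best) field_sum_of_halves)
  qed
  show ?thesis by (rule relabel_equiv_of_common_source[OF s(1) s'(1) v p])
qed


section \<open>Probability of the typical event and the limit\<close>

text \<open>A Chernoff bound with tilt \<open>exp (- 1)\<close>: the moment is at most \<open>exp (- \<alpha> $ c / 2 * n)\<close> because
  \<open>1 - exp (- 1) \<ge> 1 / 2\<close>, and the threshold gives back half of this exponent.\<close>

lemma prob_small_community:
  fixes \<alpha> :: "real ^ 'k::finite"
  assumes \<alpha>: "\<alpha> \<in> prob_vecs"
  shows "measure_pmf.prob (labels_pmf n \<alpha>) {z. real (card {i\<in>{1..n}. z i = c}) \<le> \<alpha> $ c / 4 * real n}
    \<le> exp (- (\<alpha> $ c / 4 * real n))"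
proof -
  define e where "e = exp (- 1 :: real)"
  have e: "e \<le> 1 / 2"
  proof -
    have "2 \<le> exp (1 :: real)" using exp_ge_add_one_self[of "1 :: real"] by simp
    then show ?thesis unfolding e_def exp_minus by (simp add: inverse_eq_divide divide_le_eq)
  qed
  define X where "X z = (\<Sum>i\<in>{1..n}. - of_bool (z i = c) :: real)" for z :: "nat \<Rightarrow> 'k"
  define f :: "'k \<Rightarrow> real" where "f a = exp (- of_bool (a = c))" for a
  have X: "X z = - real (card {i\<in>{1..n}. z i = c})" for z
    by (simp add: X_def sum_negf Int_def)
  have \<alpha>0: "0 \<le> \<alpha> $ a" for a using \<alpha> by (simp add: prob_vecs_def)
  have "measure_pmf.expectation (vec_pmf \<alpha>) f = (\<Sum>a\<in>UNIV. f a * \<alpha> $ a)"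
    by (subst integral_measure_pmf_real[of UNIV]) (auto simp: pmf_vec_pmf[OF \<alpha>])
  also have "\<dots> = (\<Sum>a\<in>UNIV. \<alpha> $ a - (if a = c then (1 - e) * \<alpha> $ c else 0))"
    by (intro sum.cong) (auto simp: f_def e_def algebra_simps)
  also have "\<dots> = 1 + - ((1 - e) * \<alpha> $ c)"
    using \<alpha> by (simp add: sum_subtractf prob_vecs_def)
  also have "\<dots> \<le> exp (- ((1 - e) * \<alpha> $ c))" by (rule exp_ge_add_one_self)
  also have "\<dots> \<le> exp (- (\<alpha> $ c / 2))"
  proof -
    have "1 / 2 * \<alpha> $ c \<le> (1 - e) * \<alpha> $ c" using e \<alpha>0 by (intro mult_right_mono) auto
    then show ?thesis by simp
  qed
  finally have f: "measure_pmf.expectation (vec_pmf \<alpha>) f \<le> exp (- (\<alpha> $ c / 2))" .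
  have "measure_pmf.expectation (labels_pmf n \<alpha>) (\<lambda>z. exp (X z)) =
      measure_pmf.expectation (labels_pmf n \<alpha>) (\<lambda>z. \<Prod>i\<in>{1..n}. f (z i))"
    by (simp only: X_def f_def exp_sum[OF finite_atLeastAtMost])
  also have "\<dots> = (\<Prod>i\<in>{1..n}. measure_pmf.expectation (vec_pmf \<alpha>) f)"
    unfolding labels_pmf_def
    by (rule expectation_prod_Pi_pmf) (auto simp: f_def intro: integrable_measure_pmf_finite)
  also have "\<dots> \<le> (\<Prod>i\<in>{1..n}. exp (- (\<alpha> $ c / 2)))"
    by (intro prod_mono conjI f Bochner_Integration.integral_nonneg) (simp add: f_def)
  also have "\<dots> = exp (- (\<alpha> $ c / 2 * real n))"
    by (simp add: exp_of_nat_mult[symmetric] mult.commute)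
  finally have "measure_pmf.prob (labels_pmf n \<alpha>) {z. - (\<alpha> $ c / 4 * real n) \<le> X z} \<le>
      exp (- (\<alpha> $ c / 2 * real n) - - (\<alpha> $ c / 4 * real n))"
    unfolding labels_pmf_def by (intro exponential_Markov_pmf finite_set_Pi_pmf) auto
  then show ?thesis by (simp add: X mult.commute)
qed

lemma measure_bind_pmf_le:
  assumes "\<And>x. measure_pmf.prob (N x) X \<le> c" and "0 \<le> c"
  shows "measure_pmf.prob (bind_pmf M N) X \<le> c"
proof -
  have "emeasure (bind_pmf M N) X \<le> (\<integral>\<^sup>+ x. ennreal c \<partial>measure_pmf M)"
    unfolding emeasure_bind_pmf using assms
    by (intro nn_integral_mono) (simp add: measure_pmf.emeasure_eq_measure)
  then show ?thesis
    using assms(2) by (simp add: measure_pmf.emeasure_eq_measure measure_pmf.emeasure_space_1)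
qed

lemma sbm_pmf_support:
  fixes \<alpha> :: "real ^ 'k::finite"
  assumes "(u, A) \<in> set_pmf (sbm_pmf n \<alpha> Q)"
  shows "u \<in> labelings n" "A i j \<in> {0, 1}"
proof -
  from assms have u: "u \<in> set_pmf (labels_pmf n \<alpha>)" and A: "A \<in> set_pmf (adjacency_pmf n Q u)"
    by (auto simp: sbm_pmf_def)
  have "u i = undefined" if "i \<notin> {1..n}" for i
    using u set_Pi_pmf_subset[of "{1..n}" undefined "\<lambda>_. vec_pmf \<alpha>"] that
    unfolding labels_pmf_def by blast
  then show "u \<in> labelings n" unfolding labelings_def PiE_UNIV_domain by (auto simp: PiE_iff extensional_def)
  show "A i j \<in> {0, 1}" using A by (auto simp: adjacency_pmf_def)
qed

lemma prob_atypical: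
  fixes \<alpha> :: "real ^ 'k::finite" and Q :: "real ^ 'k ^ 'k"
  assumes \<alpha>: "\<alpha> \<in> prob_vecs" and Q: "\<And>a b. 0 < Q $ a $ b" "\<And>a b. Q $ a $ b < 1"
    and n: "1 \<le> n" and K: "K = 2 * real CARD('k) ^ 2 + 1"
    and E: "\<And>u A. (u, A) \<in> set_pmf (sbm_pmf n \<alpha> Q) \<Longrightarrow> typical_adjacency n Q u K A \<Longrightarrow>
      (\<And>c. \<alpha> $ c / 4 * real n < real (card {i\<in>{1..n}. u i = c})) \<Longrightarrow> (u, A) \<in> E"
  shows "1 - (real CARD('k \<Rightarrow> 'k) * 2 ^ (CARD('k) ^ 2) * exp (real CARD('k)) / real n +
      (\<Sum>c\<in>UNIV. exp (- (\<alpha> $ c / 4 * real n)))) \<le> measure_pmf.prob (sbm_pmf n \<alpha> Q) E"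
proof -
  let ?M = "sbm_pmf n \<alpha> Q"
  let ?p = "real CARD('k \<Rightarrow> 'k) * 2 ^ (CARD('k) ^ 2) * exp (real CARD('k)) / real n"
  define B where "B = {(u, A). \<not> typical_adjacency n Q u K A}"
  define S where "S c = {u :: nat \<Rightarrow> 'k. real (card {i\<in>{1..n}. u i = c}) \<le> \<alpha> $ c / 4 * real n}" for c
  have "measure_pmf.prob ?M (- E) = measure_pmf.prob ?M (- E \<inter> set_pmf ?M)"
    by (simp add: measure_Int_set_pmf)
  also have "\<dots> \<le> measure_pmf.prob ?M (B \<union> (\<Union>c\<in>UNIV. fst -` S c))"
    using E by (intro measure_pmf.finite_measure_mono) (auto simp: B_def S_def not_le)
  also have "\<dots> \<le> measure_pmf.prob ?M B + measure_pmf.prob ?M (\<Union>c\<in>UNIV. fst -` S c)"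
    by (rule measure_Un_le) auto
  also have "measure_pmf.prob ?M B \<le> ?p"
    unfolding sbm_pmf_def
  proof (rule measure_bind_pmf_le)
    show "measure_pmf.prob (map_pmf (Pair u) (adjacency_pmf n Q u)) B \<le> ?p" for u
      using prob_not_typical_adjacency[OF Q n K, of u] by (simp add: B_def vimage_def)
  qed simp
  also have "measure_pmf.prob ?M (\<Union>c\<in>UNIV. fst -` S c) \<le>
      (\<Sum>c\<in>UNIV. measure_pmf.prob ?M (fst -` S c))"
    by (intro measure_pmf.finite_measure_subadditive_finite) auto
  also have "\<dots> \<le> (\<Sum>c\<in>UNIV. exp (- (\<alpha> $ c / 4 * real n)))"
  proof (intro sum_mono)
    fix c
    have "map_pmf fst ?M = labels_pmf n \<alpha>"
      by (simp add: sbm_pmf_def map_bind_pmf map_pmf_comp map_pmf_const bind_return_pmf')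
    then have "measure_pmf.prob ?M (fst -` S c) = measure_pmf.prob (labels_pmf n \<alpha>) (S c)"
      by (metis measure_map_pmf)
    then show "measure_pmf.prob ?M (fst -` S c) \<le> exp (- (\<alpha> $ c / 4 * real n))"
      using prob_small_community[OF \<alpha>, of n c] by (simp add: S_def)
  qed
  finally have "measure_pmf.prob ?M (- E) \<le> ?p + (\<Sum>c\<in>UNIV. exp (- (\<alpha> $ c / 4 * real n)))"
    by simp
  then show ?thesis
    using measure_pmf.prob_compl[of E ?M] by (simp add: Compl_eq_Diff_UNIV)
qed


lemma exists_row_gap:
  fixes y :: "'k::finite \<Rightarrow> 'k \<Rightarrow> real"
  assumes "\<And>c e. c \<noteq> e \<Longrightarrow> \<exists>d. y c d \<noteq> y e d"
  shows "\<exists>\<eta>>0. \<forall>c e. c \<noteq> e \<longrightarrow> (\<exists>d. 2 * \<eta> \<le> \<bar>y c d - y e d\<bar>)"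
proof -
  define G where "G = insert 1 {x \<in> (\<lambda>(c, e, d). \<bar>y c d - y e d\<bar>) ` UNIV. 0 < x}"
  have fin: "finite G" by (simp add: G_def)
  have "0 < Min G" using fin by (subst Min_gr_iff) (auto simp: G_def)
  moreover have "\<exists>d. 2 * (Min G / 2) \<le> \<bar>y c d - y e d\<bar>" if "c \<noteq> e" for c e
  proof -
    obtain d where "y c d \<noteq> y e d" using assms \<open>c \<noteq> e\<close> by blast
    then have "\<bar>y c d - y e d\<bar> \<in> G" by (auto simp: G_def intro!: image_eqI[of _ _ "(c, e, d)"])
    then show ?thesis using Min_le[OF fin] by auto
  qed
  ultimately show ?thesis by (intro exI[of _ "Min G / 2"]) auto
qed

theorem proposition2:
  fixes \<alpha>0 :: "real ^ 'k::finite" and Q0 :: "real ^ 'k ^ 'k"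
    and \<rho> :: "nat \<Rightarrow> real"
    and \<alpha>s :: "nat \<Rightarrow> real ^ 'k" and Qs :: "nat \<Rightarrow> real ^ 'k ^ 'k"
  assumes params: "\<And>n. (\<alpha>s n, Qs n) \<in> param_set"
    and A1: "\<And>n. \<alpha>s n = \<alpha>0" "\<And>a. 0 < \<alpha>0 $ a"
    and A2: "\<And>n. Qs n = \<rho> n *\<^sub>R Q0" "transpose Q0 = Q0" "\<And>a b. 0 < Q0 $ a $ b"
      "(\<Sum>a\<in>UNIV. \<Sum>b\<in>UNIV. \<alpha>0 $ a * \<alpha>0 $ b * Q0 $ a $ b) = 1"
    and distinct_columns: "\<And>a b. a \<noteq> b \<Longrightarrow> column a Q0 \<noteq> column b Q0"
    and sparsity: "filterlim (\<lambda>n. \<rho> n / (ln (real n) / real n)) at_top sequentially"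
  shows "(\<lambda>n. measure_pmf.prob (sbm_pmf n (\<alpha>s n) (Qs n))
            {(z, A). \<forall>(zVAR :: nat \<Rightarrow> 'k) (zMPL :: nat \<Rightarrow> 'k). is_var_labeling n A zVAR \<longrightarrow> is_profile_labeling n A zMPL \<longrightarrow>
               relabel_equiv n zVAR zMPL}) \<longlonglongrightarrow> 1"
proof -
  define agree where "agree n = {(z :: nat \<Rightarrow> 'k, A). \<forall>(zVAR :: nat \<Rightarrow> 'k) (zMPL :: nat \<Rightarrow> 'k).
    is_var_labeling n A zVAR \<longrightarrow> is_profile_labeling n A zMPL \<longrightarrow> relabel_equiv n zVAR zMPL}" for n
  have \<alpha>0: "\<alpha>0 \<in> prob_vecs" using params[of 0] A1(1) by (simp add: param_set_iff)
  have Q01: "0 < Qs n $ a $ b" "Qs n $ a $ b < 1" for n a b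
    using params[of n] by (auto simp: param_set_iff)
  have Qs: "Qs n \<in> conn_matrices" for n
    unfolding conn_matrices_def using params by blast
  have \<rho>: "0 < \<rho> n" for n
    using Q01(1)[of n undefined undefined] A2(3)[of undefined undefined] by (simp add: A2(1) zero_less_mult_iff)
  have Q0sym: "Q0 $ a $ b = Q0 $ b $ a" for a b using A2(2) by (simp add: transpose_def vec_eq_iff)
  have "\<exists>d. sqrt (Q0 $ c $ d) \<noteq> sqrt (Q0 $ e $ d)" if "c \<noteq> e" for c e
  proof -
    obtain d where "column c Q0 $ d \<noteq> column e Q0 $ d"
      using distinct_columns[OF \<open>c \<noteq> e\<close>] unfolding vec_eq_iff by blast
    then have "Q0 $ c $ d \<noteq> Q0 $ e $ d"
      using Q0sym[of c d] Q0sym[of e d] by (simp add: column_def)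
    then show ?thesis by (intro exI[of _ d]) simp
  qed
  then obtain \<eta> where \<eta>: "0 < \<eta>"
    and gap: "\<And>c e. c \<noteq> e \<Longrightarrow> \<exists>d. 2 * \<eta> \<le> \<bar>sqrt (Q0 $ c $ d) - sqrt (Q0 $ e $ d)\<bar>"
    using exists_row_gap[of "\<lambda>c d. sqrt (Q0 $ c $ d)"] by blast
  define \<gamma> where "\<gamma> = Min (range (\<lambda>c. \<alpha>0 $ c)) / 4"
  have \<gamma>: "0 < \<gamma>" using A1(2) by (simp add: \<gamma>_def)
  have \<gamma>_le: "\<gamma> \<le> \<alpha>0 $ c / 4" for c by (simp add: \<gamma>_def)
  define \<beta> where "\<beta> = \<gamma> / real CARD('k)"
  have \<beta>: "0 < \<beta>" using \<gamma> by (simp add: \<beta>_def)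
  define K where "K = 2 * real CARD('k) ^ 2 + 1"
  define C where "C = 14 + 6 * K + 3 * real CARD('k)"
  define \<kappa> where "\<kappa> = \<beta>\<^sup>2 * \<eta>\<^sup>2 / 4"
  have \<kappa>: "0 < \<kappa>" using \<beta> \<eta> by (simp add: \<kappa>_def)
  define p where "p n = real CARD('k \<Rightarrow> 'k) * 2 ^ (CARD('k) ^ 2) * exp (real CARD('k)) / real n +
      (\<Sum>c\<in>UNIV. exp (- (\<alpha>0 $ c / 4 * real n)))" for n
  have signal: "\<forall>\<^sub>F n in sequentially. C * ln (real n) < \<kappa> * (\<rho> n * real n)"
    using filterlim_at_top_dense[THEN iffD1, OF sparsity, rule_format, of "C / \<kappa>"] eventually_ge_at_top[of 3]
  proof eventually_elim
    case (elim n)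
    have ln0: "0 < ln (real n)" using elim(2) by simp
    have "C / \<kappa> < (\<rho> n * real n) / ln (real n)" using elim(1) by simp
    then have "C / \<kappa> * ln (real n) < \<rho> n * real n" using ln0 by (simp only: pos_less_divide_eq)
    from mult_strict_left_mono[OF this \<kappa>] show ?case using \<kappa> by simp
  qed
  have lower: "\<forall>\<^sub>F n in sequentially. 1 - p n \<le> measure_pmf.prob (sbm_pmf n (\<alpha>s n) (Qs n)) (agree n)"
    using signal eventually_ge_at_top[of 3] eventually_ge_at_top[of "CARD('k)"]
      eventually_ge_at_top[of "nat \<lceil>2 / \<beta>\<rceil>"]
  proof eventually_elim
    case (elim n)
    have "2 / \<beta> \<le> real n" using elim(4) by linarith
    then have large: "2 \<le> \<beta> * real n" using \<beta> by (simp add: divide_le_eq mult.commute)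
    show ?case
      unfolding p_def A1(1)
    proof (rule prob_atypical[OF \<alpha>0 Q01 _ K_def])
      show "1 \<le> n" using elim(2) by simp
      fix u A
      assume supp: "(u, A) \<in> set_pmf (sbm_pmf n \<alpha>0 (Qs n))" and typical: "typical_adjacency n (Qs n) u K A"
        and bal: "\<And>c. \<alpha>0 $ c / 4 * real n < real (card {i\<in>{1..n}. u i = c})"
      have balanced: "\<gamma> * real n \<le> real (card {i\<in>{1..n}. u i = c})" for c
        using bal[of c] mult_right_mono[OF \<gamma>_le, of "real n" c] by linarith
      have K0: "0 \<le> K" by (simp add: K_def)
      have signal_n: "(14 + 6 * K + 3 * real CARD('k)) * ln (real n) < \<beta>\<^sup>2 * \<eta>\<^sup>2 / 4 * (\<rho> n * real n)"
        using elim(1) unfolding C_def \<kappa>_def .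
      have "relabel_equiv n zv zp"
        if zv: "is_var_labeling n A zv" and zp: "is_profile_labeling n A zp" for zv zp :: "nat \<Rightarrow> 'k"
      proof (rule estimators_agree_on_typical_event[where u = u and P = "Qs n" and K = K and \<gamma> = \<gamma>
            and \<eta> = \<eta> and \<beta> = \<beta> and r = "\<rho> n" and ?Q0.0 = Q0])
        show "A i j \<in> {0, 1}" for i j by (rule sbm_pmf_support[OF supp])
        show "u \<in> labelings n" by (rule sbm_pmf_support[OF supp])
        show "\<gamma> * real n \<le> real (card {i\<in>{1..n}. u i = c})" for c by (rule balanced)
        show "\<exists>d. 2 * \<eta> \<le> \<bar>sqrt (Q0 $ c $ d) - sqrt (Q0 $ e $ d)\<bar>" if "c \<noteq> e" for c e
          using that by (rule gap)
        show "3 \<le> n" "CARD('k) \<le> n" by (fact elim(2,3))+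
        show "Qs n = \<rho> n *\<^sub>R Q0" "0 < \<rho> n" "Qs n \<in> conn_matrices" by (rule A2(1) \<rho> Qs)+
        show "typical_adjacency n (Qs n) u K A" by (fact typical)
        show "0 < \<eta>" by (fact \<eta>)
        show "\<beta> = \<gamma> / real CARD('k)" by (fact \<beta>_def)
        show "2 \<le> \<beta> * real n" by (fact large)
        show "0 \<le> K" by (fact K0)
        show "(14 + 6 * K + 3 * real CARD('k)) * ln (real n) < \<beta>\<^sup>2 * \<eta>\<^sup>2 / 4 * (\<rho> n * real n)"
          by (fact signal_n)
        show "is_var_labeling n A zv" "is_profile_labeling n A zp" by (fact zv zp)+
      qed
      then show "(u, A) \<in> agree n" by (simp add: agree_def)
    qed
  qed
  have lim: "(\<lambda>n. 1 - p n) \<longlonglongrightarrow> 1"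
  proof -
    have "(\<lambda>n. exp (- (\<alpha>0 $ c / 4 * real n))) \<longlonglongrightarrow> 0" for c
    proof -
      have "(\<lambda>n. exp (- (\<alpha>0 $ c / 4)) ^ n) \<longlonglongrightarrow> 0"
        using A1(2)[of c] by (intro LIMSEQ_power_zero) simp
      moreover have "exp (- (\<alpha>0 $ c / 4)) ^ n = exp (- (\<alpha>0 $ c / 4 * real n))" for n
        using exp_of_nat_mult[of n "- (\<alpha>0 $ c / 4)"] by (simp add: mult.commute)
      ultimately show ?thesis by simp
    qed
    then have "(\<lambda>n. \<Sum>c\<in>UNIV. exp (- (\<alpha>0 $ c / 4 * real n))) \<longlonglongrightarrow> (\<Sum>c\<in>(UNIV :: 'k set). 0)"
      by (intro tendsto_sum)
    moreover have "(\<lambda>n. real CARD('k \<Rightarrow> 'k) * 2 ^ (CARD('k) ^ 2) * exp (real CARD('k)) / real n) \<longlonglongrightarrow> 0"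
      by (rule lim_const_over_n)
    ultimately have "p \<longlonglongrightarrow> 0 + (\<Sum>c\<in>(UNIV :: 'k set). 0)"
      unfolding p_def by (intro tendsto_add)
    then show ?thesis using tendsto_diff[OF tendsto_const, of p 0 sequentially 1] by simp
  qed
  have "(\<lambda>n. measure_pmf.prob (sbm_pmf n (\<alpha>s n) (Qs n)) (agree n)) \<longlonglongrightarrow> 1"
    by (rule tendsto_sandwich[OF lower _ lim tendsto_const]) simp
  then show ?thesis unfolding agree_def .
qed

end
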